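(* Suppose that $1<\alpha<2$ and that either $\gamma<\beta-1$ or $E\left[X_1^{1+\gamma}1_{\{X_1>0\}}\right]<\infty$. Then for any $\epsilon>0$, $$\lim_{n\to\infty}m^{\gamma n}P\left(S_{Z_n}/Z_n\ge\epsilon\right)=\sum_{k\ge1}q_kP\left(S_k\ge\epsilon k\right).$$
   Context: Galton-Watson process: $(Z_n)_{n\ge0}$ is a Galton-Watson process with $Z_0=1$ and offspring distribution $\{p_k\}_{k\ge0}$ such that $p_0=0$, $0<p_1<1$, with finite mean $m=\sum_{k\ge1}kp_k>1$ and $E[Z_1\log Z_1]<\infty$. The Schröder constant $\gamma>0$ is defined by $p_1=m^{-\gamma}$. For $k\ge1$, $q_k=\lim_{n\to\infty}P(Z_n=k)\,m^{\gamma n}$ (these limits exist). Sums: $(X_i)_{i\ge1}$ are i.i.d. real random variables, independent of $(Z_n)$, with distribution function $F(x)=P(X_1\le x)$; $S_n=X_1+\cdots+X_n$. Standing Assumption A: (A1) $P(X_1\ge x)\sim x^{-\beta}L(x)$ as $x\to+\infty$, where $\beta>0$ and $L$ is a (positive) slowly varying function. (A2) $X_1$ is in the domain of attraction of an $\alpha$-stable law, $0<\alpha<2$: $b(k)^{-1}S_k\to U_s$ in distribution, where $U_s$ is an $\alpha$-stable random variable and $b:[0,\infty)\to[0,\infty)$ is a fixed continuous, increasing, onto function with $b(0)=0$ and $b(x)=x^{1/\alpha}s(x)$ for $x>0$ with $s:(0,\infty)\to(0,\infty)$ slowly varying. (A3) $E[X_1]=0$ if $1<\alpha<2$. Under these assumptions,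 $p_+=\lim_{x\to+\infty}\frac{1-F(x)}{1-F(x)+F(-x)}$ exists; it follows that $\alpha\le\beta$. Standing Assumption B: (B1) $U_s$ is strictly stable. (B2) If $1<\alpha<2$, then $\liminf_{x\to+\infty}s(x)\in(0,+\infty]$. (B3) If $0<p_+<1$ and $\alpha=1$, then $\int_{-x}^x yF(dy)=0$ for all $x>0$. (B4) If $p_+=0$, then $\alpha<\beta$. (B5) If $1<\alpha<2$ and $p_+>0$, then $\limsup_{n\to+\infty}\frac{F(-b(n)/[\log n]^{1/\alpha})}{(\log n)F(-b(n))}\le1$. *)

theory Defs
  imports
    "HOL-Probability.Probability"
    "HOL-Library.Landau_Symbols"
begin

section \<open>Galton-Watson processes\<close>

text \<open>Law of the sum of \<open>i\<close> independent random variables with law \<open>p\<close>, i.e. the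
  \<open>i\<close>-fold convolution power of \<open>p\<close>.\<close>

definition offspring_sum :: "nat pmf \<Rightarrow> nat \<Rightarrow> nat pmf" where
  "offspring_sum p i = map_pmf sum_list (replicate_pmf i p)"

text \<open>A Galton-Watson process with offspring law \<open>p\<close> started from one individual is the Markov
  chain on the nonnegative integers started at \<open>1\<close> whose probability of moving from \<open>i\<close> to \<open>j\<close> is
  that of \<open>i\<close> independent individuals having \<open>j\<close> children in total (the textbook
  definition of Athreya and Ney).  The third clause gives the law of
  \<open>(Z\<^sub>0, \<dots>, Z\<^sub>n)\<close> for every \<open>n\<close>.  A process constructed from
  offspring variables living on \<open>M\<close> is a special case.\<close>

definition galton_watson :: "'a measure \<Rightarrow> nat pmf \<Rightarrow> (nat \<Rightarrow> 'a \<Rightarrow> nat) \<Rightarrow> bool" where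
  "galton_watson M p Z \<longleftrightarrow>
     prob_space M \<and>
     (\<forall>n. Z n \<in> M \<rightarrow>\<^sub>M count_space UNIV) \<and>
     (\<forall>n z. measure M {\<omega> \<in> space M. \<forall>i\<le>n. Z i \<omega> = z i} =
        of_bool (z 0 = 1) * (\<Prod>i<n. pmf (offspring_sum p (z i)) (z (Suc i))))"

text \<open>Only meaningful where the limit exists; \<open>m\<close> is the offspring mean and \<open>\<gamma>\<close> the
  Schroeder constant.\<close>

definition schroeder_q :: "'a measure \<Rightarrow> (nat \<Rightarrow> 'a \<Rightarrow> nat) \<Rightarrow> real \<Rightarrow> real \<Rightarrow> nat \<Rightarrow> real" where
  "schroeder_q M Z m \<gamma> k =
     lim (\<lambda>n. measure M {\<omega> \<in> space M. Z n \<omega> = k} * m powr (\<gamma> * real n))"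

section \<open>Sums of independent variables\<close>

text \<open>Sequences of i.i.d. variables are indexed from \<open>0\<close>: \<open>X i\<close> is the variable usually
  written \<open>X\<^sub>i\<^sub>+\<^sub>1\<close>.\<close>

definition iid :: "'a measure \<Rightarrow> (nat \<Rightarrow> 'a \<Rightarrow> real) \<Rightarrow> bool" where
  "iid M X \<longleftrightarrow>
     prob_space.indep_vars M (\<lambda>_. borel) X UNIV \<and>
     (\<forall>i. distr M borel (X i) = distr M borel (X 0))"

definition partial_sum :: "(nat \<Rightarrow> 'a \<Rightarrow> real) \<Rightarrow> nat \<Rightarrow> 'a \<Rightarrow> real" where
  "partial_sum X n \<omega> = (\<Sum>i<n. X i \<omega>)"

text \<open>Independence of the two processes as random elements of the sequence spaces.\<close>

definition indep_processes ::
    "'a measure \<Rightarrow> (nat \<Rightarrow> 'a \<Rightarrow> nat) \<Rightarrow> (nat \<Rightarrow> 'a \<Rightarrow> real) \<Rightarrow> bool" where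
  "indep_processes M Z X \<longleftrightarrow>
     prob_space.indep_var M
       (\<Pi>\<^sub>M n\<in>UNIV. count_space UNIV) (\<lambda>\<omega>. \<lambda>n. Z n \<omega>)
       (\<Pi>\<^sub>M i\<in>UNIV. borel) (\<lambda>\<omega>. \<lambda>i. X i \<omega>)"

text \<open>The distribution function of the common law.\<close>

definition dist_fun :: "'a measure \<Rightarrow> (nat \<Rightarrow> 'a \<Rightarrow> real) \<Rightarrow> real \<Rightarrow> real" where
  "dist_fun M X = cdf (distr M borel (X 0))"

definition p_plus :: "'a measure \<Rightarrow> (nat \<Rightarrow> 'a \<Rightarrow> real) \<Rightarrow> real" where
  "p_plus M X =
     Lim at_top (\<lambda>x. (1 - dist_fun M X x) / (1 - dist_fun M X x + dist_fun M X (- x)))"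

section \<open>Slow variation and stable laws\<close>

text \<open>Only the values on the positive half line matter.\<close>

definition slowly_varying :: "(real \<Rightarrow> real) \<Rightarrow> bool" where
  "slowly_varying L \<longleftrightarrow>
     L \<in> borel_measurable (restrict_space borel {0<..}) \<and>
     (\<forall>x>0. L x > 0) \<and>
     (\<forall>c>0. ((\<lambda>x. L (c * x) / L x) \<longlongrightarrow> 1) at_top)"

text \<open>For independent \<open>U\<^sub>1\<close>, \<open>U\<^sub>2\<close> with law \<open>\<mu>\<close>: the variable
  \<open>a U\<^sub>1 + c U\<^sub>2\<close> has the law of \<open>(a\<^sup>\<alpha> + c\<^sup>\<alpha>)\<^sup>1\<^sup>/\<^sup>\<alpha> U\<^sub>1 + d\<close>.\<close>

definition stable_relation :: "real \<Rightarrow> real measure \<Rightarrow> real \<Rightarrow> real \<Rightarrow> real \<Rightarrow> bool" where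
  "stable_relation \<alpha> \<mu> a c d \<longleftrightarrow>
     distr \<mu> borel (\<lambda>x. a * x) \<star> distr \<mu> borel (\<lambda>x. c * x) =
     distr \<mu> borel (\<lambda>x. (a powr \<alpha> + c powr \<alpha>) powr (1 / \<alpha>) * x + d)"

text \<open>Point masses satisfy the stability relation for every \<open>\<alpha>\<close> and are excluded.\<close>

definition stable_law :: "real \<Rightarrow> real measure \<Rightarrow> bool" where
  "stable_law \<alpha> \<mu> \<longleftrightarrow>
     real_distribution \<mu> \<and> (\<forall>x. measure \<mu> {x} < 1) \<and>
     (\<forall>a>0. \<forall>c>0. \<exists>d. stable_relation \<alpha> \<mu> a c d)"

definition strictly_stable_law :: "real \<Rightarrow> real measure \<Rightarrow> bool" where
  "strictly_stable_law \<alpha> \<mu> \<longleftrightarrow>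
     stable_law \<alpha> \<mu> \<and> (\<forall>a>0. \<forall>c>0. stable_relation \<alpha> \<mu> a c 0)"

section \<open>Standing assumptions\<close>

text \<open>\<open>\<mu>\<close> is the law of the stable limit.  The function \<open>b\<close> is only constrained on
  \<open>{0..}\<close> and \<open>s\<close> only on \<open>{0<..}\<close>.  At \<open>k = 0\<close> the quotient in the
  limit theorem is \<open>0 / 0 = 0\<close>, which is irrelevant for the limit.\<close>

definition assumption_A ::
    "'a measure \<Rightarrow> (nat \<Rightarrow> 'a \<Rightarrow> real) \<Rightarrow> real \<Rightarrow> real \<Rightarrow> (real \<Rightarrow> real) \<Rightarrow>
     (real \<Rightarrow> real) \<Rightarrow> (real \<Rightarrow> real) \<Rightarrow> real measure \<Rightarrow> bool" where
  "assumption_A M X \<alpha> \<beta> L b s \<mu> \<longleftrightarrow>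
     \<comment> \<open>(A1)\<close>
     \<beta> > 0 \<and> slowly_varying L \<and>
     (\<lambda>x. measure M {\<omega> \<in> space M. X 0 \<omega> \<ge> x}) \<sim>[at_top] (\<lambda>x. x powr (- \<beta>) * L x) \<and>
     \<comment> \<open>(A2)\<close>
     0 < \<alpha> \<and> \<alpha> < 2 \<and> stable_law \<alpha> \<mu> \<and>
     continuous_on {0..} b \<and> mono_on {0..} b \<and> b ` {0..} = {0..} \<and> b 0 = 0 \<and>
     slowly_varying s \<and> (\<forall>x>0. b x = x powr (1 / \<alpha>) * s x) \<and>
     weak_conv_m (\<lambda>k. distr M borel (\<lambda>\<omega>. partial_sum X k \<omega> / b (real k))) \<mu> \<and>
     \<comment> \<open>(A3)\<close>
     (1 < \<alpha> \<longrightarrow> integrable M (X 0) \<and> (LINT \<omega>|M. X 0 \<omega>) = 0)"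

text \<open>In (B5) the convention \<open>0 / 0 = 0\<close> makes the condition hold when \<open>X 0\<close> is bounded
  below (both distribution function values then vanish for large \<open>n\<close>).\<close>

definition assumption_B ::
    "'a measure \<Rightarrow> (nat \<Rightarrow> 'a \<Rightarrow> real) \<Rightarrow> real \<Rightarrow> real \<Rightarrow>
     (real \<Rightarrow> real) \<Rightarrow> (real \<Rightarrow> real) \<Rightarrow> real measure \<Rightarrow> bool" where
  "assumption_B M X \<alpha> \<beta> b s \<mu> \<longleftrightarrow>
     \<comment> \<open>(B1)\<close>
     strictly_stable_law \<alpha> \<mu> \<and>
     \<comment> \<open>(B2)\<close>
     (1 < \<alpha> \<and> \<alpha> < 2 \<longrightarrow> Liminf at_top (\<lambda>x. ereal (s x)) > 0) \<and>
     \<comment> \<open>(B3)\<close>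
     (0 < p_plus M X \<and> p_plus M X < 1 \<and> \<alpha> = 1 \<longrightarrow>
        (\<forall>x>0. (LINT y:{-x..x}|distr M borel (X 0). y) = 0)) \<and>
     \<comment> \<open>(B4)\<close>
     (p_plus M X = 0 \<longrightarrow> \<alpha> < \<beta>) \<and>
     \<comment> \<open>(B5)\<close>
     (1 < \<alpha> \<and> \<alpha> < 2 \<and> p_plus M X > 0 \<longrightarrow>
        Limsup sequentially (\<lambda>n. ereal
          (dist_fun M X (- b (real n) / ln (real n) powr (1 / \<alpha>)) /
           (ln (real n) * dist_fun M X (- b (real n))))) \<le> 1)"

end

theory Submission
  imports Defs
begin

text \<open>
  Conditioning on \<open>Z\<^sub>n\<close> turns the probability in question into
  \<open>\<Sum>\<^sub>k P(Z\<^sub>n = k) a\<^sub>k\<close> with \<open>a\<^sub>k = P(S\<^sub>k \<ge> \<epsilon> k)\<close>.  Forcing the first individual to have a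
  single child gives \<open>P(Z\<^sub>n\<^sub>+\<^sub>1 = k) \<ge> p\<^sub>1 P(Z\<^sub>n = k)\<close>, so \<open>m\<^sup>\<gamma>\<^sup>n P(Z\<^sub>n = k)\<close> increases to
  \<open>q\<^sub>k\<close> and it suffices to show that \<open>q\<^sub>k a\<^sub>k\<close> is summable.

  The generating function \<open>f\<close> of the offspring law satisfies
  \<open>f\<^sup>n(s) = O(p\<^sub>1\<^sup>n)\<close> for \<open>s < 1\<close>, and by the \<open>Z log Z\<close> condition \<open>f\<^sup>l(1 - m\<^sup>-\<^sup>l)\<close> stays away
  from \<open>1\<close>.  Hence \<open>P(Z\<^sub>n \<le> k) = O(k\<^sup>\<gamma> m\<^sup>-\<^sup>\<gamma>\<^sup>n)\<close>, that is, \<open>q\<^sub>1 + \<dots> + q\<^sub>k = O(k\<^sup>\<gamma>)\<close>.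

  Either alternative gives \<open>E[X\<^sub>+\<^sup>1\<^sup>+\<^sup>\<gamma>] < \<infinity>\<close>.  Truncating \<open>X\<close> from below, which increases the
  mean to at most \<open>\<epsilon>/2\<close>, and a Chernoff bound for the variables truncated at \<open>\<delta> k\<close> yield
  \<open>a\<^sub>k \<le> k P(X \<ge> \<delta> k) + O(k\<^sup>-\<^sup>\<gamma>\<^sup>-\<^sup>2)\<close>.  The last term is harmless since \<open>q\<^sub>k = O(k\<^sup>\<gamma>)\<close>, and
  \<open>\<Sum>\<^sub>k q\<^sub>k k P(X \<ge> \<delta> k) \<le> E[(X\<^sub>+/\<delta>) \<Sum>\<^sub>k\<^sub>\<le>\<^sub>X\<^sub>/\<^sub>\<delta> q\<^sub>k] = O(E[X\<^sub>+\<^sup>1\<^sup>+\<^sup>\<gamma>])\<close>.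
\<close>

section \<open>Generating functions\<close>

definition pgf :: "nat pmf \<Rightarrow> real \<Rightarrow> real" where
  "pgf p s = measure_pmf.expectation p (\<lambda>k. s ^ k)"

lemma integrable_pgf: "0 \<le> s \<Longrightarrow> s \<le> 1 \<Longrightarrow> integrable (measure_pmf p) (\<lambda>k. s ^ k)" for s :: real
  by (rule measure_pmf.integrable_const_bound[where B = 1]) (auto simp: power_le_one)

lemma nn_integral_pgf:
  assumes "0 \<le> s" "s \<le> 1"
  shows "(\<integral>\<^sup>+k. ennreal (s ^ k) \<partial>measure_pmf p) = ennreal (pgf p s)"
  unfolding pgf_def by (rule nn_integral_eq_integral) (use assms integrable_pgf in auto)

lemma pgf_nonneg: "0 \<le> s \<Longrightarrow> 0 \<le> pgf p s"
  unfolding pgf_def by (intro integral_nonneg_AE) auto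

lemma pgf_mono:
  assumes "0 \<le> s" "s \<le> t" "t \<le> 1"
  shows "pgf p s \<le> pgf p t"
  unfolding pgf_def
  using assms by (intro integral_mono integrable_pgf) (auto intro: power_mono)

lemma pgf_1: "pgf p 1 = 1"
  by (simp add: pgf_def)

lemma pgf_le_1: "0 \<le> s \<Longrightarrow> s \<le> 1 \<Longrightarrow> pgf p s \<le> 1"
  using pgf_mono[of s 1 p] by (simp add: pgf_1)

lemma offspring_sum_0: "offspring_sum p 0 = return_pmf 0"
  by (simp add: offspring_sum_def)

lemma offspring_sum_Suc:
  "offspring_sum p (Suc i) = bind_pmf p (\<lambda>x. map_pmf (\<lambda>y. x + y) (offspring_sum p i))"
  by (simp add: offspring_sum_def map_bind_pmf pmf.map_comp o_def map_pmf_def[symmetric])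

lemma offspring_sum_1: "offspring_sum p (Suc 0) = p"
  by (simp add: offspring_sum_Suc offspring_sum_0 bind_return_pmf')

lemma pgf_offspring_sum:
  assumes "0 \<le> s" "s \<le> 1"
  shows "pgf (offspring_sum p i) s = pgf p s ^ i"
proof (induction i)
  case 0
  then show ?case by (simp add: offspring_sum_0 pgf_def)
next
  case (Suc i)
  \<comment> \<open>In \<open>ennreal\<close> the integral over \<open>bind_pmf\<close> iterates
    without integrability side conditions.\<close>
  have "ennreal (pgf (offspring_sum p (Suc i)) s) =
      (\<integral>\<^sup>+x. \<integral>\<^sup>+y. ennreal (s ^ x) * ennreal (s ^ y) \<partial>measure_pmf (offspring_sum p i) \<partial>measure_pmf p)"
    using assms
    by (simp add: nn_integral_pgf[symmetric] offspring_sum_Suc ennreal_mult power_add)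
  also have "\<dots> = ennreal (pgf p s) * ennreal (pgf (offspring_sum p i) s)"
    using assms by (simp add: nn_integral_cmult nn_integral_multc nn_integral_pgf)
  also have "\<dots> = ennreal (pgf p s * pgf (offspring_sum p i) s)"
    using assms by (simp add: ennreal_mult pgf_nonneg)
  finally show ?case
    using Suc assms by (simp add: pgf_nonneg)
qed

section \<open>Laws of the Galton-Watson process\<close>

text \<open>The initial size \<open>i\<close> is a parameter, although the process starts at 1,
  because conditioning on the first generation restarts the chain at its size.\<close>

primrec gw_law :: "nat pmf \<Rightarrow> nat \<Rightarrow> nat \<Rightarrow> nat pmf" where
  "gw_law p 0 i = return_pmf i"
| "gw_law p (Suc n) i = bind_pmf (gw_law p n i) (offspring_sum p)"

lemma gw_law_Suc_left: "gw_law p (Suc n) i = bind_pmf (offspring_sum p i) (gw_law p n)"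
proof (induction n)
  case 0
  then show ?case by (simp add: bind_return_pmf bind_return_pmf')
next
  case (Suc n)
  have "gw_law p (Suc (Suc n)) i = bind_pmf (gw_law p (Suc n) i) (offspring_sum p)"
    by simp
  also have "\<dots> = bind_pmf (bind_pmf (offspring_sum p i) (gw_law p n)) (offspring_sum p)"
    by (subst Suc) simp
  finally show ?case by (simp add: bind_assoc_pmf)
qed

text \<open>The last generation replaces \<open>s\<close> by \<open>pgf p s\<close>, by
  \<open>pgf_offspring_sum\<close>; hence the induction runs over arbitrary
  \<open>s\<close>.\<close>

lemma pgf_gw_law:
  assumes "0 \<le> s" "s \<le> 1"
  shows "pgf (gw_law p n 1) s = (pgf p ^^ n) s"
  using assms
proof (induction n arbitrary: s)
  case 0
  then show ?case by (simp add: pgf_def)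
next
  case (Suc n)
  have "ennreal (pgf (gw_law p (Suc n) 1) s) =
      (\<integral>\<^sup>+k. ennreal (pgf p s ^ k) \<partial>measure_pmf (gw_law p n 1))"
    using Suc.prems by (simp add: nn_integral_pgf[symmetric] pgf_offspring_sum[symmetric])
  also have "\<dots> = ennreal (pgf (gw_law p n 1) (pgf p s))"
    using Suc.prems by (simp add: nn_integral_pgf pgf_nonneg pgf_le_1)
  also have "\<dots> = ennreal ((pgf p ^^ Suc n) s)"
    using Suc.prems Suc.IH[of "pgf p s"] by (simp add: pgf_nonneg pgf_le_1 funpow_swap1)
  finally show ?case
    using Suc.prems Suc.IH[of "pgf p s"]
    by (subst (asm) ennreal_inj) (auto simp: pgf_nonneg pgf_le_1 funpow_swap1 simp flip: Suc.IH)
qed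

lemma pmf_bind_ge: "pmf p a * pmf (f a) k \<le> pmf (bind_pmf p f) k"
proof -
  have "pmf p a * pmf (f a) k = measure_pmf.expectation p (\<lambda>x. pmf (f x) k * indicator {a} x)"
    by (subst integral_measure_pmf[where A = "{a}"]) (auto simp: indicator_def)
  also have "\<dots> \<le> measure_pmf.expectation p (\<lambda>x. pmf (f x) k)"
    by (intro integral_mono measure_pmf.integrable_const_bound[where B = 1])
       (auto simp: indicator_def pmf_le_1)
  finally show ?thesis by (simp add: pmf_bind)
qed

text \<open>Only the event that the ancestor has exactly one child is kept. This makes the law
  divided by \<open>pmf p 1 ^ n\<close> monotone in \<open>n\<close>.\<close>

lemma gw_law_Suc_ge: "pmf p 1 * pmf (gw_law p n 1) k \<le> pmf (gw_law p (Suc n) 1) k"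
  unfolding gw_law_Suc_left using pmf_bind_ge[of "offspring_sum p 1" 1 "gw_law p n" k]
  by (simp add: offspring_sum_1)

text \<open>At \<open>s = 1 - 1 / (2 * real k)\<close> Bernoulli's inequality gives
  \<open>s ^ k \<ge> 1 / 2\<close>, so the indicator of \<open>i \<le> k\<close> is at most
  \<open>2 * s ^ i\<close>. The factor 2 in the denominator keeps Bernoulli's bound away from
  0.\<close>

lemma gw_law_le_pgf:
  assumes "0 < k"
  shows "measure (gw_law p n 1) {..k} \<le> 2 * (pgf p ^^ n) (1 - 1 / (2 * real k))"
proof -
  let ?s = "1 - 1 / (2 * real k)"
  have s: "0 \<le> ?s" "?s \<le> 1" using assms by (auto simp: field_simps)
  have half: "1 / 2 \<le> ?s ^ k"
    using Bernoulli_inequality[of "- 1 / (2 * real k)" k] assms by (simp add: field_simps)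
  have "measure (gw_law p n 1) {..k} = measure_pmf.expectation (gw_law p n 1) (indicator {..k})"
    by simp
  also have "\<dots> \<le> measure_pmf.expectation (gw_law p n 1) (\<lambda>i. 2 * ?s ^ i)"
  proof (intro integral_mono integrable_mult_right integrable_pgf s)
    fix i
    show "indicator {..k} i \<le> 2 * ?s ^ i"
      using half power_decreasing[of i k ?s] s by (auto simp: indicator_def)
  qed (auto intro!: integrable_real_indicator simp: less_top[symmetric])
  also have "\<dots> = 2 * (pgf p ^^ n) ?s"
    using pgf_gw_law[OF s] by (simp add: pgf_def)
  finally show ?thesis .
qed

text \<open>The definition prescribes only the probabilities of finite paths. The one-step identity
  \<open>markov\<close> is extracted from them, and the marginal laws follow by induction on
  \<open>n\<close>.\<close>

lemma galton_watson_law: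
  assumes gw: "galton_watson M p Z"
  shows "measure M {\<omega> \<in> space M. Z n \<omega> = k} = pmf (gw_law p n 1) k"
proof -
  interpret prob_space M using gw by (simp add: galton_watson_def)
  have [measurable]: "Z n \<in> M \<rightarrow>\<^sub>M count_space UNIV" for n
    using gw by (simp add: galton_watson_def)
  have path: "emeasure M {\<omega> \<in> space M. \<forall>i\<le>n. Z i \<omega> = z i} =
      ennreal (of_bool (z 0 = 1) * (\<Prod>i<n. pmf (offspring_sum p (z i)) (z (Suc i))))" for n z
    using gw by (simp add: galton_watson_def emeasure_eq_measure)
  \<comment> \<open>The Markov property at time \<open>n\<close> follows by summing over the path up to time \<open>n - 1\<close>.\<close>
  define \<pi> where "\<pi> n \<omega> = map (\<lambda>i. Z i \<omega>) [0..<n]" for n \<omega>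
  have path_eq: "{\<omega> \<in> space M. \<pi> (Suc n) \<omega> = l} = {\<omega> \<in> space M. \<forall>i\<le>n. Z i \<omega> = l ! i}"
    if "length l = Suc n" for l n
    using that by (auto simp: \<pi>_def list_eq_iff_nth_eq less_Suc_eq_le simp del: upt_Suc)
  have path_meas [measurable]: "{\<omega> \<in> space M. \<pi> n \<omega> = l} \<in> sets M" for n l
  proof (cases "length l = n")
    case True
    then have "{\<omega> \<in> space M. \<pi> n \<omega> = l} = {\<omega> \<in> space M. \<forall>i<n. Z i \<omega> = l ! i}"
      by (auto simp: \<pi>_def list_eq_iff_nth_eq)
    then show ?thesis by simp
  next
    case False
    then have "{\<omega> \<in> space M. \<pi> n \<omega> = l} = {}"
      by (auto simp: \<pi>_def)
    then show ?thesis by (metis sets.empty_sets)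
  qed
  \<comment> \<open>Paths are encoded as lists because these form a countable type, so that summing
    over all of them is an integral over a counting measure. Lists of length other than
    \<open>n\<close> contribute 0.\<close>
  have split: "emeasure M A = (\<integral>\<^sup>+l. emeasure M ({\<omega> \<in> space M. \<pi> n \<omega> = l} \<inter> A) \<partial>count_space UNIV)"
    if [measurable]: "A \<in> sets M" for A n
  proof -
    have "A = (\<Union>l. {\<omega> \<in> space M. \<pi> n \<omega> = l} \<inter> A)"
      using sets.sets_into_space[OF that] by auto
    then have "emeasure M A = emeasure M (\<Union>l. {\<omega> \<in> space M. \<pi> n \<omega> = l} \<inter> A)" by simp
    also have "\<dots> = (\<integral>\<^sup>+l. emeasure M ({\<omega> \<in> space M. \<pi> n \<omega> = l} \<inter> A) \<partial>count_space UNIV)"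
      by (rule emeasure_UN_countable) (auto simp: disjoint_family_on_def)
    finally show ?thesis .
  qed
  have markov: "emeasure M {\<omega> \<in> space M. Z n \<omega> = j \<and> Z (Suc n) \<omega> = k} =
      emeasure M {\<omega> \<in> space M. Z n \<omega> = j} * ennreal (pmf (offspring_sum p j) k)" for n j k
  proof -
    have step: "emeasure M ({\<omega> \<in> space M. \<pi> n \<omega> = l} \<inter> {\<omega> \<in> space M. Z n \<omega> = j \<and> Z (Suc n) \<omega> = k}) =
        emeasure M ({\<omega> \<in> space M. \<pi> n \<omega> = l} \<inter> {\<omega> \<in> space M. Z n \<omega> = j}) * ennreal (pmf (offspring_sum p j) k)"
      for l
    proof (cases "length l = n")
      case True
      \<comment> \<open>The list \<open>l @ [j, k]\<close> serves both events: this one reads its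
        entries only up to index \<open>n\<close>, so \<open>k\<close> does not matter here.\<close>
      have 1: "{\<omega> \<in> space M. \<pi> n \<omega> = l} \<inter> {\<omega> \<in> space M. Z n \<omega> = j} =
          {\<omega> \<in> space M. \<forall>i\<le>n. Z i \<omega> = (l @ [j, k]) ! i}"
        using True by (auto simp: \<pi>_def list_eq_iff_nth_eq nth_append le_less)
      have 2: "{\<omega> \<in> space M. \<pi> n \<omega> = l} \<inter> {\<omega> \<in> space M. Z n \<omega> = j \<and> Z (Suc n) \<omega> = k} =
          {\<omega> \<in> space M. \<forall>i\<le>Suc n. Z i \<omega> = (l @ [j, k]) ! i}"
        using True by (subst path_eq[symmetric]) (auto simp: \<pi>_def)
      show ?thesis
        unfolding 1 2 path using True
        by (subst ennreal_mult[symmetric]) (auto simp: prod_nonneg nth_append)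
    next
      case False
      then have empty: "{\<omega> \<in> space M. \<pi> n \<omega> = l} = {}"
        by (auto simp: \<pi>_def)
      show ?thesis unfolding empty by simp
    qed
    show ?thesis
      by (subst (1 2) split[of _ n]) (simp_all add: step nn_integral_multc)
  qed
  have "emeasure M {\<omega> \<in> space M. Z n \<omega> = k} = ennreal (pmf (gw_law p n 1) k)"
  proof (induction n arbitrary: k)
    case 0
    show ?case
      using path[of 0 "\<lambda>_. k"] by (simp add: pmf_return indicator_def)
  next
    case (Suc n)
    have "{\<omega> \<in> space M. Z (Suc n) \<omega> = k} = (\<Union>j. {\<omega> \<in> space M. Z n \<omega> = j \<and> Z (Suc n) \<omega> = k})"
      by auto
    then have "emeasure M {\<omega> \<in> space M. Z (Suc n) \<omega> = k} =
        (\<integral>\<^sup>+j. emeasure M {\<omega> \<in> space M. Z n \<omega> = j \<and> Z (Suc n) \<omega> = k} \<partial>count_space UNIV)"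
      by (simp only:) (rule emeasure_UN_countable, auto simp: disjoint_family_on_def)
    also have "\<dots> = (\<integral>\<^sup>+j. ennreal (pmf (offspring_sum p j) k) \<partial>measure_pmf (gw_law p n 1))"
      by (simp add: markov Suc nn_integral_measure_pmf)
    finally show ?case
      by (simp add: ennreal_pmf_bind)
  qed
  then show ?thesis by (simp add: emeasure_eq_measure)
qed

section \<open>Lower tail of the population size\<close>

text \<open>About \<open>ln y / ln m\<close> terms are cut off at 1, and the others are dominated by
  a geometric series with sum \<open>m / (m - 1)\<close>. The induction peels off one cut-off term
  and passes to \<open>y / m\<close>. With \<open>y\<close> the number of children, the logarithm is
  the one in the Z log Z condition.\<close>

lemma sum_min_geometric_le:
  fixes m y :: real
  assumes m: "1 < m" and "1 \<le> y"
  shows "(\<Sum>i<l. min 1 (y / m ^ Suc i)) \<le> ln y / ln m + m / (m - 1)"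
  using assms(2)
proof (induction l arbitrary: y)
  case 0
  then show ?case using m by simp
next
  case (Suc l)
  show ?case
  proof (cases "m \<le> y")
    case True
    have "(\<Sum>i<Suc l. min 1 (y / m ^ Suc i)) = min 1 (y / m) + (\<Sum>i<l. min 1 (y / m / m ^ Suc i))"
      by (subst sum.lessThan_Suc_shift) (simp add: field_simps)
    also have "\<dots> \<le> 1 + (ln (y / m) / ln m + m / (m - 1))"
      using True m Suc.IH[of "y / m"] by (intro add_mono) auto
    also have "ln (y / m) / ln m = ln y / ln m - 1"
      using True m by (simp add: ln_div field_simps)
    finally show ?thesis by simp
  next
    case False
    have "norm (1 / m) < 1" using m by simp
    then have geo: "summable (\<lambda>i. (1 / m) ^ i)" "(\<Sum>i. (1 / m) ^ i) = m / (m - 1)"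
      using m summable_geometric[of "1 / m"] suminf_geometric[of "1 / m"] by (auto simp: field_simps)
    have "(\<Sum>i<Suc l. min 1 (y / m ^ Suc i)) \<le> (\<Sum>i<Suc l. (1 / m) ^ i)"
    proof (rule sum_mono)
      fix i
      have "y / m ^ Suc i \<le> m / m ^ Suc i"
        using False m by (intro divide_right_mono) auto
      then show "min 1 (y / m ^ Suc i) \<le> (1 / m) ^ i"
        using m by (simp add: power_divide)
    qed
    also have "\<dots> \<le> (\<Sum>i. (1 / m) ^ i)"
      using m by (intro sum_le_suminf geo(1)) auto
    also have "\<dots> \<le> ln y / ln m + m / (m - 1)"
      unfolding geo(2) using Suc.prems m by simp
    finally show ?thesis .
  qed
qed

text \<open>With \<open>y = k * u \<le> 1\<close>, the chain \<open>(1 - u) ^ k \<le> exp (- y)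
  \<le> 1 / (1 + y) \<le> 1 - y + y * y\<close> gives the bound; for \<open>y > 1\<close> the
  left-hand side is 0. The cut-off by \<open>min\<close> keeps the error linear in \<open>k\<close>,
  so that a first moment suffices to integrate it.\<close>

lemma one_minus_power_ge:
  fixes u :: real
  assumes "0 \<le> u" "u \<le> 1"
  shows "u * (real k - real k * min 1 (real k * u)) \<le> 1 - (1 - u) ^ k"
proof (cases "real k * u \<le> 1")
  case True
  define y where "y = real k * u"
  have y: "0 \<le> y" using assms by (simp add: y_def)
  have "(1 - u) ^ k \<le> exp (- u) ^ k"
    using assms exp_ge_add_one_self[of "- u"] by (intro power_mono) auto
  also have "\<dots> = inverse (exp y)"
    by (simp add: y_def exp_of_nat_mult exp_minus power_inverse)
  also have "\<dots> \<le> inverse (1 + y)"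
    using y exp_ge_add_one_self[of y] by (intro le_imp_inverse_le) auto
  also have "\<dots> \<le> 1 - y + y * y"
  proof -
    have "1 \<le> (1 - y + y * y) * (1 + y)"
      using y by (simp add: algebra_simps)
    then show ?thesis
      using y by (simp add: field_simps)
  qed
  finally show ?thesis
    using True by (simp add: y_def min_def algebra_simps)
next
  case False
  then show ?thesis
    using assms by (simp add: min_def power_le_one)
qed

text \<open>\<open>1 - pgf p (1 - u)\<close> is at least \<open>u * (m - pgf_defect p u)\<close>.  Summability of
  \<open>pgf_defect p (1 / m ^ i)\<close> over \<open>i\<close> is what the \<open>Z log Z\<close> condition provides.\<close>

definition pgf_defect :: "nat pmf \<Rightarrow> real \<Rightarrow> real" where
  "pgf_defect p u = measure_pmf.expectation p (\<lambda>k. real k * min 1 (real k * u))"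

lemma integrable_pmf_indicator: "integrable (measure_pmf q) (indicator A :: 'b \<Rightarrow> real)"
  by (rule integrable_real_indicator) (auto simp: less_top[symmetric])

locale supercritical =
  fixes p :: "nat pmf" and m \<gamma> :: real
  assumes p0: "pmf p 0 = 0" and p1_pos: "0 < pmf p 1" and p1_less: "pmf p 1 < 1"
    and int: "integrable (measure_pmf p) real"
    and m_def: "m = measure_pmf.expectation p real" and m_gt: "1 < m"
    and xlogx: "integrable (measure_pmf p) (\<lambda>k. real k * ln (real k))"
    and \<gamma>_pos: "0 < \<gamma>" and p1_eq: "pmf p 1 = m powr (- \<gamma>)"
begin

lemma AE_pos: "AE k in measure_pmf p. 0 < k"
  using p0 by (auto simp: AE_measure_pmf_iff set_pmf_iff intro!: Nat.gr0I)

text \<open>There is no mass at 0, and \<open>s ^ k \<le> s ^ 2\<close> for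
  \<open>k \<ge> 2\<close>. For small \<open>s\<close> one application of \<open>pgf p\<close> thus
  costs little more than the factor \<open>pmf p 1\<close>.\<close>

lemma pgf_le_quadratic:
  assumes "0 \<le> s" "s \<le> 1"
  shows "pgf p s \<le> s * (pmf p 1 + (1 - pmf p 1) * s)"
proof -
  have "pgf p s \<le> measure_pmf.expectation p (\<lambda>k. s ^ 2 + (s - s ^ 2) * indicator {1} k)"
    unfolding pgf_def
  proof (rule integral_mono_AE)
    show "AE k in measure_pmf p. s ^ k \<le> s\<^sup>2 + (s - s\<^sup>2) * indicator {1} k"
      using AE_pos
    proof eventually_elim
      case (elim k)
      then show ?case
        using assms power_decreasing[of 2 k s] by (cases "k = 1") auto
    qed
  qed (use assms in \<open>auto intro!: integrable_pgf integrable_real_indicator simp: less_top[symmetric]\<close>)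
  also have "\<dots> = s ^ 2 + (s - s ^ 2) * pmf p 1"
    by (subst Bochner_Integration.integral_add)
       (auto intro!: integrable_real_indicator simp: less_top[symmetric] pmf.rep_eq)
  also have "\<dots> = s * (pmf p 1 + (1 - pmf p 1) * s)"
    by (simp add: algebra_simps power2_eq_square)
  finally show ?thesis .
qed

section \<open>The first-order defect of the generating function near 1\<close>

lemma integrable_pgf_defect:
  "0 \<le> u \<Longrightarrow> integrable (measure_pmf p) (\<lambda>k. real k * min 1 (real k * u))"
  by (rule Bochner_Integration.integrable_bound[OF int])
     (auto intro!: mult_right_le_one_le simp: abs_mult)

lemma pgf_defect_mono:
  "0 \<le> u \<Longrightarrow> u \<le> v \<Longrightarrow> pgf_defect p u \<le> pgf_defect p v"
  unfolding pgf_defect_def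
  by (intro integral_mono integrable_pgf_defect) (auto intro!: mult_left_mono min.mono)

lemma pgf_defect_nonneg: "0 \<le> u \<Longrightarrow> 0 \<le> pgf_defect p u"
  unfolding pgf_defect_def by (intro integral_nonneg_AE) auto

text \<open>Keeping only the outcome of a single child already leaves a positive gap below
  \<open>m\<close>. This bounds the factors \<open>1 - pgf_defect p u / m\<close> away from
  0.\<close>

lemma pgf_defect_upper:
  assumes "0 \<le> u" "u \<le> 1"
  shows "pmf p 1 * (1 - u) \<le> m - pgf_defect p u"
proof -
  have "pmf p 1 * (1 - u) = measure_pmf.expectation p (\<lambda>k. indicator {1} k * (1 - u))"
    by (simp add: pmf.rep_eq)
  also have "\<dots> \<le> measure_pmf.expectation p (\<lambda>k. real k - real k * min 1 (real k * u))"
    using assms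
    by (intro integral_mono integrable_pgf_defect Bochner_Integration.integrable_diff int)
       (auto intro!: mult_right_le_one_le integrable_mult_left integrable_pmf_indicator split: split_indicator)
  also have "\<dots> = m - pgf_defect p u"
    unfolding m_def pgf_defect_def
    using assms by (intro Bochner_Integration.integral_diff int integrable_pgf_defect) auto
  finally show ?thesis .
qed

lemma pgf_one_minus_le:
  assumes "0 \<le> u" "u \<le> 1"
  shows "pgf p (1 - u) \<le> 1 - u * (m - pgf_defect p u)"
proof -
  have "u * (m - pgf_defect p u) = measure_pmf.expectation p (\<lambda>k. u * (real k - real k * min 1 (real k * u)))"
    unfolding m_def pgf_defect_def
    using assms int integrable_pgf_defect[of u] by simp
  also have "\<dots> \<le> measure_pmf.expectation p (\<lambda>k. 1 - (1 - u) ^ k)"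
    using assms
    by (intro integral_mono one_minus_power_ge integrable_mult_right
        Bochner_Integration.integrable_diff int integrable_pgf_defect integrable_pgf) auto
  also have "\<dots> = 1 - pgf p (1 - u)"
    unfolding pgf_def using assms integrable_pgf[of "1 - u" p] by simp
  finally show ?thesis by simp
qed

section \<open>Iterates of the generating function\<close>

lemma funpow_pgf_bounds:
  "0 \<le> s \<Longrightarrow> s \<le> 1 \<Longrightarrow> 0 \<le> (pgf p ^^ n) s \<and> (pgf p ^^ n) s \<le> 1"
  by (induction n) (auto simp: pgf_nonneg pgf_le_1)

lemma funpow_pgf_mono:
  "0 \<le> s \<Longrightarrow> s \<le> t \<Longrightarrow> t \<le> 1 \<Longrightarrow> (pgf p ^^ n) s \<le> (pgf p ^^ n) t"
  by (induction n) (auto intro!: pgf_mono simp: funpow_pgf_bounds)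

text \<open>Sum and expectation are exchanged and \<open>sum_min_geometric_le\<close> is applied
  with \<open>y = real k\<close>. The bound does not depend on \<open>l\<close>, and it is finite by
  the Z log Z condition, which enters here.\<close>

lemma sum_pgf_defect_le:
  "(\<Sum>i<l. pgf_defect p (1 / m ^ Suc i)) \<le>
     measure_pmf.expectation p (\<lambda>k. real k * ln (real k) / ln m + real k * (m / (m - 1)))"
proof -
  have "(\<Sum>i<l. pgf_defect p (1 / m ^ Suc i)) =
      measure_pmf.expectation p (\<lambda>k. \<Sum>i<l. real k * min 1 (real k * (1 / m ^ Suc i)))"
    unfolding pgf_defect_def
    using m_gt by (subst Bochner_Integration.integral_sum) (rule integrable_pgf_defect, simp_all)
  also have "\<dots> \<le> measure_pmf.expectation p (\<lambda>k. real k * ln (real k) / ln m + real k * (m / (m - 1)))"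
  proof (intro integral_mono_AE Bochner_Integration.integrable_sum integrable_pgf_defect
      Bochner_Integration.integrable_add integrable_divide integrable_mult_left xlogx int)
    show "AE k in measure_pmf p. (\<Sum>i<l. real k * min 1 (real k * (1 / m ^ Suc i))) \<le>
        real k * ln (real k) / ln m + real k * (m / (m - 1))"
      using AE_pos
    proof eventually_elim
      case (elim k)
      have "real k * (\<Sum>i<l. min 1 (real k / m ^ Suc i)) \<le> real k * (ln (real k) / ln m + m / (m - 1))"
        using elim by (intro mult_left_mono sum_min_geometric_le m_gt) auto
      then show ?case
        by (simp add: sum_distrib_left distrib_left)
    qed
  qed (use m_gt in auto)
  finally show ?thesis .
qed

text \<open>The innermost application takes \<open>1 - y / m ^ Suc l\<close> to at most
  \<open>1 - y * c / m ^ l\<close>, by \<open>pgf_one_minus_le\<close>. The lost factor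
  \<open>c\<close> is absorbed into \<open>y\<close>, which is why \<open>y\<close> is arbitrary in
  the induction.\<close>

lemma funpow_pgf_le:
  assumes "0 \<le> y" "y \<le> 1"
  shows "(pgf p ^^ l) (1 - y / m ^ l) \<le> 1 - y * (\<Prod>i<l. 1 - pgf_defect p (1 / m ^ Suc i) / m)"
  using assms
proof (induction l arbitrary: y)
  case 0
  then show ?case by simp
next
  case (Suc l)
  define c where "c = 1 - pgf_defect p (1 / m ^ Suc l) / m"
  define w where "w = y / m ^ Suc l"
  have pow: "1 \<le> m ^ j" for j
    using m_gt by (intro one_le_power) auto
  have w: "0 \<le> w" "w \<le> 1" "w \<le> 1 / m ^ Suc l"
    using Suc.prems m_gt pow[of "Suc l"]
    by (auto simp: w_def divide_le_eq intro: divide_right_mono order_trans simp del: power_Suc)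
  have u: "0 \<le> 1 / m ^ Suc l" "1 / m ^ Suc l \<le> 1"
    using m_gt pow[of "Suc l"] by (auto simp: divide_le_eq simp del: power_Suc)
  then have "0 \<le> pmf p 1 * (1 - 1 / m ^ Suc l)"
    by (intro mult_nonneg_nonneg) auto
  then have "pgf_defect p (1 / m ^ Suc l) \<le> m"
    using pgf_defect_upper[OF u] by simp
  then have c: "0 \<le> c" "c \<le> 1"
    using m_gt pgf_defect_nonneg[OF u(1)] by (auto simp: c_def divide_le_eq simp del: power_Suc)
  have "pgf p (1 - w) \<le> 1 - w * (m - pgf_defect p w)"
    using w by (intro pgf_one_minus_le)
  also have "\<dots> \<le> 1 - w * (m - pgf_defect p (1 / m ^ Suc l))"
    using w pgf_defect_mono[of w "1 / m ^ Suc l"] by (auto intro!: mult_left_mono)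
  also have "w * (m - pgf_defect p (1 / m ^ Suc l)) = y * c / m ^ l"
    using m_gt by (simp add: w_def c_def field_simps)
  finally have le: "pgf p (1 - w) \<le> 1 - y * c / m ^ l" .
  have yc: "0 \<le> y * c" "y * c \<le> 1"
    using Suc.prems c by (auto intro: mult_le_one)
  have "(pgf p ^^ Suc l) (1 - w) = (pgf p ^^ l) (pgf p (1 - w))"
    by (simp add: funpow_swap1)
  also have "\<dots> \<le> (pgf p ^^ l) (1 - y * c / m ^ l)"
    using le w yc m_gt by (intro funpow_pgf_mono) (auto simp: pgf_nonneg)
  also have "\<dots> \<le> 1 - y * c * (\<Prod>i<l. 1 - pgf_defect p (1 / m ^ Suc i) / m)"
    using yc by (rule Suc.IH)
  finally show ?case
    by (simp add: w_def c_def ac_simps)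
qed

text \<open>In the product of \<open>funpow_pgf_le\<close> every factor is at least \<kappa> and the
  defects have sum at most \<open>G\<close>, so the product stays above a positive constant.\<close>

lemma funpow_pgf_bounded_away:
  obtains s0 where "0 \<le> s0" "s0 < 1" "\<And>l. (pgf p ^^ l) (1 - 1 / m ^ l) \<le> s0"
proof -
  \<comment> \<open>This is the gap of \<open>pgf_defect_upper\<close> at \<open>u = 1 / m\<close>,
    the largest argument that occurs, divided by \<open>m\<close>.\<close>
  define \<kappa> where "\<kappa> = pmf p 1 * (1 - 1 / m) / m"
  define G where "G = measure_pmf.expectation p (\<lambda>k. real k * ln (real k) / ln m + real k * (m / (m - 1)))"
  have \<kappa>: "0 < \<kappa>" using m_gt p1_pos by (simp add: \<kappa>_def)
  have prod: "exp (- G / (m * \<kappa>)) \<le> (\<Prod>i<l. 1 - pgf_defect p (1 / m ^ Suc i) / m)" for l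
  proof -
    have "exp (- (pgf_defect p (1 / m ^ Suc i) / (m * \<kappa>))) \<le> 1 - pgf_defect p (1 / m ^ Suc i) / m" for i
    proof -
      define d where "d = pgf_defect p (1 / m ^ Suc i)"
      have pow: "m \<le> m ^ Suc i"
        using m_gt by (simp add: one_le_power)
      then have u: "0 \<le> 1 / m ^ Suc i" "1 / m ^ Suc i \<le> 1 / m"
        using m_gt by (auto intro!: divide_left_mono simp del: power_Suc)
      then have u1: "1 / m ^ Suc i \<le> 1"
        using m_gt by (intro order_trans[OF u(2)]) auto
      have "m * \<kappa> = pmf p 1 * (1 - 1 / m)"
        using m_gt by (simp add: \<kappa>_def)
      also have "\<dots> \<le> pmf p 1 * (1 - 1 / m ^ Suc i)"
        using u p1_pos by (intro mult_left_mono) auto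
      also have "\<dots> \<le> m - d"
        unfolding d_def using u u1 by (intro pgf_defect_upper)
      finally have ge: "\<kappa> \<le> 1 - d / m"
        using m_gt by (simp add: field_simps)
      have d: "0 \<le> d" using u unfolding d_def by (intro pgf_defect_nonneg)
      define e where "e = d / m"
      have e: "0 \<le> e" "\<kappa> \<le> 1 - e" using ge d m_gt by (auto simp: e_def)
      \<comment> \<open>The aim is \<open>exp (- e / \<kappa>) \<le> 1 - e\<close>. It comes from
        \<open>ln x \<le> x - 1\<close> at \<open>x = 1 / (1 - e)\<close>, together with
        \<open>\<kappa> \<le> 1 - e\<close>.\<close>
      have "- (d / (m * \<kappa>)) = - (e / \<kappa>)" by (simp add: e_def)
      also have "\<dots> \<le> - (e / (1 - e))"
        using e \<kappa> by (simp add: frac_le)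
      also have "\<dots> = 1 - 1 / (1 - e)"
      proof -
        have "1 - e \<noteq> 0" using e \<kappa> by linarith
        then show ?thesis by (simp add: field_simps)
      qed
      also have "\<dots> \<le> ln (1 - e)"
        using e \<kappa> ln_le_minus_one[of "1 / (1 - e)"] by (simp add: ln_div)
      finally have "exp (- (d / (m * \<kappa>))) \<le> exp (ln (1 - e))"
        by simp
      also have "\<dots> = 1 - d / m"
        using e \<kappa> by (simp add: e_def)
      finally show ?thesis
        by (simp add: d_def)
    qed
    then have "(\<Prod>i<l. exp (- (pgf_defect p (1 / m ^ Suc i) / (m * \<kappa>)))) \<le>
        (\<Prod>i<l. 1 - pgf_defect p (1 / m ^ Suc i) / m)"
      by (intro prod_mono) auto
    moreover have "(\<Prod>i<l. exp (- (pgf_defect p (1 / m ^ Suc i) / (m * \<kappa>)))) =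
        exp (- (\<Sum>i<l. pgf_defect p (1 / m ^ Suc i)) / (m * \<kappa>))"
      by (simp add: exp_sum[symmetric] sum_negf sum_divide_distrib)
    moreover have "- G / (m * \<kappa>) \<le> - (\<Sum>i<l. pgf_defect p (1 / m ^ Suc i)) / (m * \<kappa>)"
      using sum_pgf_defect_le[of l] \<kappa> m_gt unfolding G_def[symmetric]
      by (intro divide_right_mono) auto
    moreover from this have "exp (- G / (m * \<kappa>)) \<le> exp (- (\<Sum>i<l. pgf_defect p (1 / m ^ Suc i)) / (m * \<kappa>))"
      by (simp only: exp_le_cancel_iff)
    ultimately show ?thesis by linarith
  qed
  have bound: "(pgf p ^^ l) (1 - 1 / m ^ l) \<le> 1 - exp (- G / (m * \<kappa>))" for l
    using funpow_pgf_le[of 1 l] prod[of l] by simp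
  show ?thesis
  proof (rule that[OF _ _ bound])
    \<comment> \<open>For \<open>l = 0\<close> the left-hand side of \<open>bound\<close> is
      0.\<close>
    show "0 \<le> 1 - exp (- G / (m * \<kappa>))" using bound[of 0] by simp
  qed simp
qed

text \<open>Two passes over \<open>pgf_le_quadratic\<close>. A crude one gives
  \<open>F n \<le> r ^ n * s0\<close> with \<open>r < 1\<close>. Inserting this yields
  \<open>F (Suc n) \<le> pmf p 1 * (1 + B * r ^ n) * F n\<close>, and the product of the factors
  \<open>1 + B * r ^ n\<close> is bounded by \<open>exp (B / (1 - r))\<close>.\<close>

lemma funpow_pgf_le_p1:
  assumes s0: "0 \<le> s0" "s0 < 1"
  obtains C where "0 < C" "\<And>n. (pgf p ^^ n) s0 \<le> C * pmf p 1 ^ n"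
proof -
  define r where "r = pmf p 1 + (1 - pmf p 1) * s0"
  define B where "B = (1 - pmf p 1) / pmf p 1"
  have B: "0 \<le> B" using p1_pos p1_less by (simp add: B_def)
  have r: "0 \<le> r" "r < 1"
  proof -
    show "0 \<le> r" using s0 p1_pos p1_less by (simp add: r_def)
    have "(1 - pmf p 1) * s0 < (1 - pmf p 1) * 1"
      using s0 p1_less by (intro mult_strict_left_mono) auto
    then show "r < 1" by (simp add: r_def)
  qed
  define F where "F n = (pgf p ^^ n) s0" for n
  have F: "0 \<le> F n" "F n \<le> 1" for n
    using funpow_pgf_bounds[of s0 n] s0 by (auto simp: F_def)
  have step: "F (Suc n) \<le> F n * (pmf p 1 + (1 - pmf p 1) * F n)" for n
    using pgf_le_quadratic[of "F n"] F[of n] by (simp add: F_def)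
  have geo: "F n \<le> r ^ n * s0" for n
  proof (induction n)
    case 0
    then show ?case by (simp add: F_def)
  next
    case (Suc n)
    have "F n \<le> 1 * s0"
      using Suc r s0 mult_right_mono[of "r ^ n" 1 s0] by (auto simp: power_le_one)
    then have "F n * (pmf p 1 + (1 - pmf p 1) * F n) \<le> F n * r"
      using F[of n] p1_less by (auto simp: r_def intro!: mult_left_mono)
    also have "\<dots> \<le> r ^ n * s0 * r"
      using Suc r by (intro mult_right_mono)
    finally show ?case using step[of n] by (simp add: ac_simps)
  qed
  have main: "F n \<le> pmf p 1 ^ n * exp (B * (\<Sum>i<n. r ^ i))" for n
  proof (induction n)
    case 0
    then show ?case using s0 by (simp add: F_def)
  next
    case (Suc n)
    have "F n \<le> r ^ n * 1"
      using r s0 by (intro order_trans[OF geo] mult_left_mono) auto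
    then have "F n * (pmf p 1 + (1 - pmf p 1) * F n) \<le> F n * (pmf p 1 + (1 - pmf p 1) * r ^ n)"
      using F[of n] p1_less by (intro mult_left_mono add_left_mono) auto
    also have "pmf p 1 + (1 - pmf p 1) * r ^ n = pmf p 1 * (1 + B * r ^ n)"
      using p1_pos by (simp add: B_def field_simps)
    also have "F n * (pmf p 1 * (1 + B * r ^ n)) \<le>
        (pmf p 1 ^ n * exp (B * (\<Sum>i<n. r ^ i))) * (pmf p 1 * exp (B * r ^ n))"
      using Suc p1_pos r B F[of n] exp_ge_add_one_self[of "B * r ^ n"]
      by (intro mult_mono) (auto intro!: add_nonneg_nonneg mult_nonneg_nonneg)
    also have "\<dots> = pmf p 1 ^ Suc n * exp (B * (\<Sum>i<Suc n. r ^ i))"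
      by (simp add: algebra_simps exp_add)
    finally show ?case using step[of n] by simp
  qed
  have "(\<Sum>i<n. r ^ i) \<le> 1 / (1 - r)" for n
    using r sum_le_suminf[of "\<lambda>i. r ^ i" "{..<n}"] suminf_geometric[of r] by simp
  then have "exp (B * (\<Sum>i<n. r ^ i)) \<le> exp (B * (1 / (1 - r)))" for n
    using B by (auto intro: mult_left_mono simp del: times_divide_eq_right)
  then have "F n \<le> exp (B * (1 / (1 - r))) * pmf p 1 ^ n" for n
    unfolding mult.commute[of _ "pmf p 1 ^ n"]
    using p1_pos by (intro order_trans[OF main] mult_left_mono) auto
  then show ?thesis
    by (intro that[of "exp (B * (1 / (1 - r)))"]) (auto simp: F_def)
qed

text \<open>Take \<open>l\<close> minimal with \<open>2 * k \<le> m ^ l\<close>. The first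
  \<open>l\<close> iterations bring \<open>1 - 1 / (2 * k)\<close> below \<open>s0\<close>, and each
  of the remaining \<open>n - l\<close> gains a factor \<open>pmf p 1\<close>, up to a constant. The
  missing \<open>l\<close> factors cost \<open>m powr (\<gamma> * l)\<close>, which is of order
  \<open>k powr \<gamma>\<close> by minimality of \<open>l\<close>.\<close>

lemma gw_law_lower_tail:
  obtains C where "0 < C"
    "\<And>n k. 0 < k \<Longrightarrow> measure (gw_law p n 1) {..k} \<le> C * real k powr \<gamma> * pmf p 1 ^ n"
proof -
  obtain s0 where s0: "0 \<le> s0" "s0 < 1" "\<And>l. (pgf p ^^ l) (1 - 1 / m ^ l) \<le> s0"
    using funpow_pgf_bounded_away by blast
  obtain C where C: "0 < C" "\<And>n. (pgf p ^^ n) s0 \<le> C * pmf p 1 ^ n"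
    using funpow_pgf_le_p1[OF s0(1,2)] by blast
  \<comment> \<open>The summand \<open>2 * C\<close> serves the case \<open>l \<le> n\<close>; the
    summand 1 serves \<open>n < l\<close>, where the probability is simply bounded by 1.\<close>
  define D where "D = 2 * C + 1"
  have main: "measure (gw_law p n 1) {..k} \<le> D * (2 * m) powr \<gamma> * real k powr \<gamma> * pmf p 1 ^ n"
    if k: "0 < k" for n k
  proof -
    define l where "l = (LEAST l. 2 * real k \<le> m ^ l)"
    have "\<exists>l. 2 * real k \<le> m ^ l"
      using real_arch_pow[OF m_gt, of "2 * real k"] by (auto intro: less_imp_le)
    then have l: "2 * real k \<le> m ^ l"
      unfolding l_def by (rule LeastI_ex)
    have "l \<noteq> 0" using l k by (cases l) auto
    then have "\<not> 2 * real k \<le> m ^ (l - 1)"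
      unfolding l_def by (intro not_less_Least) auto
    then have ml: "m ^ l \<le> 2 * m * real k"
      using \<open>l \<noteq> 0\<close> m_gt by (cases l) (auto simp: mult_left_mono)
    have "inverse (pmf p 1 ^ l) = (m powr \<gamma>) ^ l"
      by (simp add: p1_eq powr_minus power_inverse del: One_nat_def)
    also have "\<dots> = (m ^ l) powr \<gamma>"
      using m_gt by (simp add: powr_realpow[symmetric] powr_powr mult.commute)
    also have "\<dots> \<le> (2 * m * real k) powr \<gamma>"
      using ml \<gamma>_pos m_gt by (intro powr_mono2) auto
    also have "\<dots> = (2 * m) powr \<gamma> * real k powr \<gamma>"
      using m_gt by (simp add: powr_mult)
    finally have inv: "inverse (pmf p 1 ^ l) \<le> (2 * m) powr \<gamma> * real k powr \<gamma>" .
    have "measure (gw_law p n 1) {..k} \<le> D * (pmf p 1 ^ n * inverse (pmf p 1 ^ l))"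
    proof (cases "l \<le> n")
      case True
      have le: "1 - 1 / (2 * real k) \<le> 1 - 1 / m ^ l"
        using l k m_gt by (auto intro!: divide_left_mono)
      have "measure (gw_law p n 1) {..k} \<le> 2 * (pgf p ^^ n) (1 - 1 / (2 * real k))"
        using k by (rule gw_law_le_pgf)
      also have "(pgf p ^^ n) (1 - 1 / (2 * real k)) =
          (pgf p ^^ (n - l)) ((pgf p ^^ l) (1 - 1 / (2 * real k)))"
        using True by (metis funpow_add le_add_diff_inverse2 o_apply)
      also have "\<dots> \<le> (pgf p ^^ (n - l)) s0"
      proof (rule funpow_pgf_mono)
        show "0 \<le> (pgf p ^^ l) (1 - 1 / (2 * real k))"
          using k funpow_pgf_bounds[of "1 - 1 / (2 * real k)" l] by (auto simp: field_simps)
        show "(pgf p ^^ l) (1 - 1 / (2 * real k)) \<le> s0"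
          using k le m_gt by (intro order_trans[OF funpow_pgf_mono s0(3)]) (auto simp: field_simps)
      qed (use s0 in auto)
      also have "\<dots> \<le> C * pmf p 1 ^ (n - l)"
        by (rule C)
      also have "pmf p 1 ^ (n - l) = pmf p 1 ^ n * inverse (pmf p 1 ^ l)"
        using True p1_pos by (simp add: power_diff divide_inverse)
      also have "2 * (C * (pmf p 1 ^ n * inverse (pmf p 1 ^ l))) \<le> D * (pmf p 1 ^ n * inverse (pmf p 1 ^ l))"
        using p1_pos by (simp add: D_def algebra_simps)
      finally show ?thesis by simp
    next
      case False
      have "measure (gw_law p n 1) {..k} \<le> 1"
        by simp
      also have "1 \<le> pmf p 1 ^ n * inverse (pmf p 1 ^ l)"
        using False p1_pos p1_less power_decreasing[of n l "pmf p 1"] by (simp add: field_simps)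
      also have "\<dots> \<le> D * (pmf p 1 ^ n * inverse (pmf p 1 ^ l))"
        using C p1_pos by (simp add: D_def algebra_simps)
      finally show ?thesis .
    qed
    also have "\<dots> \<le> D * (pmf p 1 ^ n * ((2 * m) powr \<gamma> * real k powr \<gamma>))"
      using inv C p1_pos by (intro mult_left_mono) (auto simp: D_def)
    finally show ?thesis by (simp add: ac_simps)
  qed
  show ?thesis
    by (rule that[of "D * (2 * m) powr \<gamma>"]) (use main C m_gt in \<open>auto simp: D_def\<close>)
qed

section \<open>Rescaled laws and their increasing limits\<close>

definition scaled_law :: "nat \<Rightarrow> nat \<Rightarrow> real" where
  "scaled_law n k = pmf (gw_law p n 1) k * m powr (\<gamma> * real n)"

definition scaled_limit :: "nat \<Rightarrow> real" where
  "scaled_limit k = lim (\<lambda>n. scaled_law n k)"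

lemma scaled_law_eq: "scaled_law n k = pmf (gw_law p n 1) k / pmf p 1 ^ n"
proof -
  have "pmf p 1 ^ n = m powr (- \<gamma> * real n)"
    using m_gt by (simp add: p1_eq powr_realpow[symmetric] powr_powr del: One_nat_def)
  then show ?thesis
    by (simp add: scaled_law_def powr_minus field_simps)
qed

lemma scaled_law_nonneg: "0 \<le> scaled_law n k"
  by (simp add: scaled_law_def)

lemma incseq_scaled_law: "incseq (\<lambda>n. scaled_law n k)"
proof (rule incseq_SucI)
  fix n
  have "scaled_law n k = pmf p 1 * pmf (gw_law p n 1) k / pmf p 1 ^ Suc n"
    using p1_pos by (simp add: scaled_law_eq del: One_nat_def)
  also have "\<dots> \<le> scaled_law (Suc n) k"
    unfolding scaled_law_eq by (intro divide_right_mono gw_law_Suc_ge) simp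
  finally show "scaled_law n k \<le> scaled_law (Suc n) k" .
qed

lemma sum_scaled_law_le:
  obtains C where "0 < C" "\<And>n K. 0 < K \<Longrightarrow> (\<Sum>k=1..K. scaled_law n k) \<le> C * real K powr \<gamma>"
proof -
  obtain C where C: "0 < C"
    "\<And>n k. 0 < k \<Longrightarrow> measure (gw_law p n 1) {..k} \<le> C * real k powr \<gamma> * pmf p 1 ^ n"
    using gw_law_lower_tail by blast
  have "(\<Sum>k=1..K. scaled_law n k) \<le> C * real K powr \<gamma>" if "0 < K" for n K
  proof -
    have "(\<Sum>k=1..K. pmf (gw_law p n 1) k) = measure (gw_law p n 1) {1..K}"
      by (simp add: measure_measure_pmf_finite)
    also have "\<dots> \<le> measure (gw_law p n 1) {..K}"
      by (intro measure_pmf.finite_measure_mono) auto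
    also have "\<dots> \<le> C * real K powr \<gamma> * pmf p 1 ^ n"
      using that by (rule C)
    finally show ?thesis
      unfolding scaled_law_eq sum_divide_distrib[symmetric]
      using p1_pos by (subst pos_divide_le_eq) auto
  qed
  with C(1) show ?thesis by (rule that)
qed

text \<open>The sequence increases and is bounded by \<open>sum_scaled_law_le\<close> with
  \<open>K = k\<close>.\<close>

lemma scaled_law_tendsto:
  assumes k: "0 < k"
  shows "(\<lambda>n. scaled_law n k) \<longlonglongrightarrow> scaled_limit k"
proof -
  obtain C where C: "\<And>n K. 0 < K \<Longrightarrow> (\<Sum>k=1..K. scaled_law n k) \<le> C * real K powr \<gamma>"
    using sum_scaled_law_le by blast
  have bound: "scaled_law n k \<le> C * real k powr \<gamma>" for n
  proof -
    have "scaled_law n k \<le> (\<Sum>i=1..k. scaled_law n i)"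
      using k by (intro member_le_sum) (auto simp: scaled_law_nonneg)
    also have "\<dots> \<le> C * real k powr \<gamma>" using k by (rule C)
    finally show ?thesis .
  qed
  obtain x where "(\<lambda>n. scaled_law n k) \<longlonglongrightarrow> x"
    by (rule incseq_convergent[OF incseq_scaled_law, of k "C * real k powr \<gamma>"]) (use bound in auto)
  then show ?thesis by (simp add: scaled_limit_def limI)
qed

lemma scaled_law_le_limit: "0 < k \<Longrightarrow> scaled_law n k \<le> scaled_limit k"
  by (rule incseq_le[OF incseq_scaled_law scaled_law_tendsto])

lemma scaled_limit_nonneg: "0 < k \<Longrightarrow> 0 \<le> scaled_limit k"
  using scaled_law_le_limit[of k 0] scaled_law_nonneg[of 0 k] by simp

text \<open>The bound is on the sum as a whole: adding up termwise bounds of order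
  \<open>k powr \<gamma>\<close> would lose a factor \<open>K\<close>, and the moment of order
  \<open>1 + \<gamma>\<close> would no longer suffice.\<close>

lemma sum_scaled_limit_le:
  obtains C where "0 < C" "\<And>K. 0 < K \<Longrightarrow> (\<Sum>k=1..K. scaled_limit k) \<le> C * real K powr \<gamma>"
proof -
  obtain C where C: "0 < C"
    "\<And>n K. 0 < K \<Longrightarrow> (\<Sum>k=1..K. scaled_law n k) \<le> C * real K powr \<gamma>"
    using sum_scaled_law_le by blast
  have "(\<Sum>k=1..K. scaled_limit k) \<le> C * real K powr \<gamma>" if "0 < K" for K
  proof (rule LIMSEQ_le_const2)
    show "(\<lambda>n. \<Sum>k=1..K. scaled_law n k) \<longlonglongrightarrow> (\<Sum>k=1..K. scaled_limit k)"
      by (intro tendsto_sum scaled_law_tendsto) auto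
  qed (use C(2)[OF that] in blast)
  with C(1) show ?thesis by (rule that)
qed

end

section \<open>Large deviations of sums\<close>

text \<open>A second-order Taylor bound with the square weakened to the power \<open>a\<close>,
  since for \<gamma> < 1 no second moment is assumed.\<close>

lemma exp_le_one_plus_powr:
  fixes t a :: real
  assumes a: "1 \<le> a" "a \<le> 2"
  shows "exp t \<le> 1 + t + \<bar>t\<bar> powr a * exp (max t 0)"
proof -
  consider "1 < t" | "0 \<le> t" "t \<le> 1" | "-1 \<le> t" "t < 0" | "t < -1" by linarith
  then show ?thesis
  proof cases
    case 1
    have "1 \<le> t powr a" using 1 a by (intro ge_one_powr_ge_zero) auto
    then have "1 * exp t \<le> t powr a * exp t"
      by (rule mult_right_mono) simp
    then have "exp t \<le> 1 + t + t powr a * exp t" using 1 by linarith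
    then show ?thesis using 1 by (simp add: max_def)
  next
    case 2
    have "t powr 2 * 1 \<le> t powr a * exp t"
      using 2 a by (intro mult_mono powr_mono') auto
    moreover have "t powr 2 = t\<^sup>2"
      using 2 by (cases "t = 0") (auto simp: powr_numeral)
    ultimately show ?thesis
      using 2 exp_bound[of t] by (simp add: max_def)
  next
    case 3
    define y where "y = - t"
    have y: "0 < y" "y \<le> 1" using 3 by (auto simp: y_def)
    have "exp t = inverse (exp y)" by (simp add: y_def exp_minus)
    also have "\<dots> \<le> inverse (1 + y)"
      using y by (intro le_imp_inverse_le) (auto intro: exp_ge_add_one_self)
    also have "\<dots> \<le> 1 - y + y\<^sup>2"
    proof -
      have "1 \<le> (1 - y + y\<^sup>2) * (1 + y)"
        using y by (simp add: algebra_simps power2_eq_square)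
      then show ?thesis using y by (simp add: field_simps)
    qed
    also have "y\<^sup>2 = y powr 2" using y by (simp add: powr_numeral)
    also have "\<dots> \<le> y powr a" using y a by (intro powr_mono') auto
    finally show ?thesis using 3 by (simp add: y_def)
  next
    case 4
    have "\<bar>t\<bar> powr 1 \<le> \<bar>t\<bar> powr a"
      using 4 a by (intro powr_mono) auto
    moreover have "exp t \<le> 1" using 4 by simp
    moreover have "\<bar>t\<bar> powr 1 = - t" using 4 by simp
    ultimately have "exp t \<le> 1 + t + \<bar>t\<bar> powr a" by linarith
    then show ?thesis using 4 by simp
  qed
qed

section \<open>Chernoff bounds for truncated variables, and moments from tails\<close>

context prob_space
begin

lemma integral_identically_distributed:
  fixes V W :: "'a \<Rightarrow> real" and g :: "real \<Rightarrow> real"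
  assumes [measurable]: "V \<in> borel_measurable M" "W \<in> borel_measurable M" "g \<in> borel_measurable borel"
    and "distr M borel V = distr M borel W"
  shows "expectation (\<lambda>\<omega>. g (V \<omega>)) = expectation (\<lambda>\<omega>. g (W \<omega>))"
    "integrable M (\<lambda>\<omega>. g (V \<omega>)) \<longleftrightarrow> integrable M (\<lambda>\<omega>. g (W \<omega>))"
  using assms(4) integral_distr[of V M borel g] integral_distr[of W M borel g]
    integrable_distr_eq[of V M borel g] integrable_distr_eq[of W M borel g] by auto

lemma prob_identically_distributed:
  fixes V W :: "'a \<Rightarrow> real"
  assumes [measurable]: "V \<in> borel_measurable M" "W \<in> borel_measurable M"
    and "distr M borel V = distr M borel W"
  shows "prob {\<omega> \<in> space M. x \<le> V \<omega>} = prob {\<omega> \<in> space M. x \<le> W \<omega>}"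
proof -
  have "prob {\<omega> \<in> space M. x \<le> U \<omega>} = measure (distr M borel U) {x..}"
    if [measurable]: "U \<in> borel_measurable M" for U
    by (subst measure_distr) (auto intro!: arg_cong[where f = prob])
  then show ?thesis using assms by simp
qed

text \<open>Truncation from above lowers the mean, does not increase the absolute value because
  \<open>0 \<le> y\<close>, and bounds the exponential in \<open>exp_le_one_plus_powr\<close> by
  \<open>exp (h * y)\<close>. Then \<open>1 + x \<le> exp x\<close>.\<close>

lemma exponential_moment_truncated:
  fixes V :: "'a \<Rightarrow> real"
  assumes [measurable]: "V \<in> borel_measurable M"
    and a: "1 \<le> a" "a \<le> 2" and moment: "integrable M (\<lambda>\<omega>. \<bar>V \<omega>\<bar> powr a)"
    and mean: "expectation V \<le> \<epsilon>" and h: "0 \<le> h" and y: "0 \<le> y"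
  shows "expectation (\<lambda>\<omega>. exp (h * min (V \<omega>) y)) \<le>
      exp (h * \<epsilon> + h powr a * exp (h * y) * expectation (\<lambda>\<omega>. \<bar>V \<omega>\<bar> powr a))"
    and "integrable M (\<lambda>\<omega>. exp (h * min (V \<omega>) y))"
proof -
  have "\<bar>v\<bar> \<le> 1 + \<bar>v\<bar> powr a" for v :: real
    using powr_mono[of 1 a "\<bar>v\<bar>"] a by (cases "1 \<le> \<bar>v\<bar>") (auto intro: order_trans[of _ 1])
  then have V: "integrable M V"
    by (intro Bochner_Integration.integrable_bound[of M "\<lambda>\<omega>. 1 + \<bar>V \<omega>\<bar> powr a" V]
        Bochner_Integration.integrable_add moment) auto
  have Y: "integrable M (\<lambda>\<omega>. min (V \<omega>) y)"
    using V by (intro integrable_min) auto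
  show E: "integrable M (\<lambda>\<omega>. exp (h * min (V \<omega>) y))"
    by (rule integrable_const_bound[where B = "exp (h * y)"]) (use h in \<open>auto intro!: mult_left_mono\<close>)
  define K where "K = h powr a * exp (h * y)"
  have "expectation (\<lambda>\<omega>. exp (h * min (V \<omega>) y)) \<le>
      expectation (\<lambda>\<omega>. 1 + h * min (V \<omega>) y + K * \<bar>V \<omega>\<bar> powr a)"
  proof (intro integral_mono E Bochner_Integration.integrable_add integrable_mult_right Y moment)
    fix \<omega>
    have "exp (h * min (V \<omega>) y) \<le> 1 + h * min (V \<omega>) y +
        \<bar>h * min (V \<omega>) y\<bar> powr a * exp (max (h * min (V \<omega>) y) 0)"
      using a by (rule exp_le_one_plus_powr)
    also have "\<bar>h * min (V \<omega>) y\<bar> powr a * exp (max (h * min (V \<omega>) y) 0) \<le>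
        (h * \<bar>V \<omega>\<bar>) powr a * exp (h * y)"
      using h y a
      by (intro mult_mono powr_mono2) (auto simp: abs_mult min_def intro!: mult_left_mono)
    also have "\<dots> = K * \<bar>V \<omega>\<bar> powr a"
      using h by (simp add: K_def powr_mult)
    finally show "exp (h * min (V \<omega>) y) \<le> 1 + h * min (V \<omega>) y + K * \<bar>V \<omega>\<bar> powr a"
      by simp
  qed auto
  also have "\<dots> = 1 + h * expectation (\<lambda>\<omega>. min (V \<omega>) y) + K * expectation (\<lambda>\<omega>. \<bar>V \<omega>\<bar> powr a)"
    using Y moment by (simp add: prob_space)
  also have "expectation (\<lambda>\<omega>. min (V \<omega>) y) \<le> \<epsilon>"
    using Y V by (intro order_trans[OF integral_mono mean]) auto
  also have "1 + h * \<epsilon> + K * expectation (\<lambda>\<omega>. \<bar>V \<omega>\<bar> powr a) \<le>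
      exp (h * \<epsilon> + K * expectation (\<lambda>\<omega>. \<bar>V \<omega>\<bar> powr a))"
    using exp_ge_add_one_self[of "h * \<epsilon> + K * expectation (\<lambda>\<omega>. \<bar>V \<omega>\<bar> powr a)"] by linarith
  finally show "expectation (\<lambda>\<omega>. exp (h * min (V \<omega>) y)) \<le>
      exp (h * \<epsilon> + h powr a * exp (h * y) * expectation (\<lambda>\<omega>. \<bar>V \<omega>\<bar> powr a))"
    using h by (simp add: K_def mult_left_mono)
qed

text \<open>Either some summand reaches \<open>y\<close>, which the union bound controls, or
  truncation at \<open>y\<close> leaves the sum unchanged and Markov's inequality applies to its
  exponential. The gap between the mean bound \<open>\<epsilon> / 2\<close> and the level \<epsilon>
  produces the negative exponent.\<close>

lemma chernoff_truncated:
  fixes V :: "nat \<Rightarrow> 'a \<Rightarrow> real"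
  assumes indep: "indep_vars (\<lambda>_. borel) V UNIV"
    and ident: "\<And>i. distr M borel (V i) = distr M borel (V 0)"
    and a: "1 \<le> a" "a \<le> 2" and moment: "integrable M (\<lambda>\<omega>. \<bar>V 0 \<omega>\<bar> powr a)"
    and mean: "expectation (V 0) \<le> \<epsilon> / 2" and h: "0 \<le> h" and y: "0 \<le> y"
  shows "prob {\<omega> \<in> space M. \<epsilon> * real k \<le> (\<Sum>i<k. V i \<omega>)} \<le>
      real k * prob {\<omega> \<in> space M. y \<le> V 0 \<omega>} +
      exp (real k * (h powr a * exp (h * y) * expectation (\<lambda>\<omega>. \<bar>V 0 \<omega>\<bar> powr a)) - h * \<epsilon> * real k / 2)"
proof -
  have V [measurable]: "V i \<in> borel_measurable M" for i
    using indep by (auto simp: indep_vars_def)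
  define Y where "Y i \<omega> = exp (h * min (V i \<omega>) y)" for i \<omega>
  have Ym [measurable]: "Y i \<in> borel_measurable M" for i
    unfolding Y_def by measurable
  define B where "B = h powr a * exp (h * y) * expectation (\<lambda>\<omega>. \<bar>V 0 \<omega>\<bar> powr a)"
  have Y: "integrable M (Y i)" "expectation (Y i) \<le> exp (h * (\<epsilon> / 2) + B)" for i
    using exponential_moment_truncated[OF V a moment mean h y]
      integral_identically_distributed[OF V V _ ident, of "\<lambda>v. exp (h * min v y)" i]
    by (simp_all add: Y_def[abs_def] B_def)
  have indY: "indep_vars (\<lambda>_. borel) Y {..<k}"
    unfolding Y_def
    by (rule indep_vars_compose2[where M' = "\<lambda>_. borel", OF indep_vars_subset[OF indep]]) auto
  have Y0: "0 \<le> expectation (Y i)" for i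
    by (intro integral_nonneg_AE) (auto simp: Y_def)
  have expP: "(\<Prod>i<k. Y i \<omega>) = exp (h * (\<Sum>i<k. min (V i \<omega>) y))" for \<omega>
    by (simp add: Y_def exp_sum[symmetric] sum_distrib_left)
  have "prob {\<omega> \<in> space M. \<epsilon> * real k \<le> (\<Sum>i<k. min (V i \<omega>) y)} \<le>
      prob {\<omega> \<in> space M. exp (h * (\<epsilon> * real k)) \<le> (\<Prod>i<k. Y i \<omega>)}"
  proof (rule finite_measure_mono)
    show "{\<omega> \<in> space M. \<epsilon> * real k \<le> (\<Sum>i<k. min (V i \<omega>) y)} \<subseteq>
        {\<omega> \<in> space M. exp (h * (\<epsilon> * real k)) \<le> (\<Prod>i<k. Y i \<omega>)}"
      unfolding expP exp_le_cancel_iff using h by (blast intro: mult_left_mono)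
  qed measurable
  also have "\<dots> \<le> expectation (\<lambda>\<omega>. \<Prod>i<k. Y i \<omega>) / exp (h * (\<epsilon> * real k))"
    by (rule integral_Markov_inequality_measure[where A = "{}", OF indep_vars_integrable[OF _ indY]])
       (use Y in \<open>auto simp: expP\<close>)
  also have "expectation (\<lambda>\<omega>. \<Prod>i<k. Y i \<omega>) = (\<Prod>i<k. expectation (Y i))"
    by (rule indep_vars_lebesgue_integral) (use indY Y in auto)
  also have "(\<Prod>i<k. expectation (Y i)) / exp (h * (\<epsilon> * real k)) \<le>
      (\<Prod>i<k. exp (h * (\<epsilon> / 2) + B)) / exp (h * (\<epsilon> * real k))"
    using Y Y0 by (intro divide_right_mono prod_mono) auto
  also have "\<dots> = exp (real k * (h * (\<epsilon> / 2) + B)) / exp (h * (\<epsilon> * real k))"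
    by (simp add: exp_of_nat_mult)
  also have "\<dots> = exp (real k * B - h * \<epsilon> * real k / 2)"
    by (simp add: exp_diff[symmetric] algebra_simps)
  finally have trunc: "prob {\<omega> \<in> space M. \<epsilon> * real k \<le> (\<Sum>i<k. min (V i \<omega>) y)} \<le>
      exp (real k * B - h * \<epsilon> * real k / 2)" .
  have "prob {\<omega> \<in> space M. \<epsilon> * real k \<le> (\<Sum>i<k. V i \<omega>)} \<le>
      prob ((\<Union>i<k. {\<omega> \<in> space M. y \<le> V i \<omega>}) \<union> {\<omega> \<in> space M. \<epsilon> * real k \<le> (\<Sum>i<k. min (V i \<omega>) y)})"
  proof (intro finite_measure_mono subsetI)
    fix \<omega> assume \<omega>: "\<omega> \<in> {\<omega> \<in> space M. \<epsilon> * real k \<le> (\<Sum>i<k. V i \<omega>)}"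
    show "\<omega> \<in> (\<Union>i<k. {\<omega> \<in> space M. y \<le> V i \<omega>}) \<union>
        {\<omega> \<in> space M. \<epsilon> * real k \<le> (\<Sum>i<k. min (V i \<omega>) y)}"
    proof (cases "\<exists>i<k. y \<le> V i \<omega>")
      case False
      then have "(\<Sum>i<k. min (V i \<omega>) y) = (\<Sum>i<k. V i \<omega>)"
        by (intro sum.cong) auto
      then show ?thesis using \<omega> by simp
    qed (use \<omega> in auto)
  qed auto
  also have "\<dots> \<le> prob (\<Union>i<k. {\<omega> \<in> space M. y \<le> V i \<omega>}) +
      prob {\<omega> \<in> space M. \<epsilon> * real k \<le> (\<Sum>i<k. min (V i \<omega>) y)}"
    by (rule measure_Un_le) auto
  also have "prob (\<Union>i<k. {\<omega> \<in> space M. y \<le> V i \<omega>}) \<le> (\<Sum>i<k. prob {\<omega> \<in> space M. y \<le> V i \<omega>})"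
    by (intro finite_measure_subadditive_finite) auto
  also have "\<dots> = real k * prob {\<omega> \<in> space M. y \<le> V 0 \<omega>}"
    by (subst prob_identically_distributed[OF V V ident]) simp
  finally show ?thesis
    using trunc by (simp add: B_def)
qed

lemma sum_large_deviation:
  fixes V :: "nat \<Rightarrow> 'a \<Rightarrow> real"
  assumes indep: "indep_vars (\<lambda>_. borel) V UNIV"
    and ident: "\<And>i. distr M borel (V i) = distr M borel (V 0)"
    and a: "1 < a" "a \<le> 2" and moment: "integrable M (\<lambda>\<omega>. \<bar>V 0 \<omega>\<bar> powr a)"
    and mean: "expectation (V 0) \<le> \<epsilon> / 2" and \<epsilon>: "0 < \<epsilon>" and N: "0 < N"
  obtains \<delta> C where "0 < \<delta>" "0 < C"
    "\<And>k. 0 < k \<Longrightarrow> prob {\<omega> \<in> space M. \<epsilon> * real k \<le> (\<Sum>i<k. V i \<omega>)} \<le>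
      real k * prob {\<omega> \<in> space M. \<delta> * real k \<le> V 0 \<omega>} + C * real k powr (- N)"
proof -
  \<comment> \<open>With \<open>h = c ln k / (\<delta> k)\<close> the gain \<open>h \<epsilon> k / 2\<close> is \<open>N ln k\<close>, whereas the error
    \<open>k h\<^sup>a exp (h \<delta> k)\<close> is \<open>O(k powr (- c) * ln k powr a)\<close> and hence bounded.\<close>
  define c where "c = (a - 1) / 2"
  define \<delta> where "\<delta> = c * \<epsilon> / (2 * N)"
  define D where "D = expectation (\<lambda>\<omega>. \<bar>V 0 \<omega>\<bar> powr a)"
  define B where "B = (c / \<delta>) powr a * (a / c) powr a * D"
  have c: "0 < c" and \<delta>: "0 < \<delta>"
    using a \<epsilon> N by (auto simp: c_def \<delta>_def)
  have D: "0 \<le> D" unfolding D_def by (intro integral_nonneg_AE) auto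
  have "prob {\<omega> \<in> space M. \<epsilon> * real k \<le> (\<Sum>i<k. V i \<omega>)} \<le>
      real k * prob {\<omega> \<in> space M. \<delta> * real k \<le> V 0 \<omega>} + exp B * real k powr (- N)"
    if k: "0 < k" for k
  proof -
    define h where "h = c * ln (real k) / (\<delta> * real k)"
    have ln: "0 \<le> ln (real k)" using k by simp
    have h: "0 \<le> h" using ln c \<delta> by (simp add: h_def)
    have hy: "exp (h * (\<delta> * real k)) = real k powr c"
      using k \<delta> by (simp add: h_def powr_def)
    \<comment> \<open>The power of the logarithm costs \<open>k powr c\<close>. With
      \<open>c = (a - 1) / 2\<close> the exponents \<open>c\<close>, \<open>1 + c\<close> and
      \<open>- a\<close> then add up to 0.\<close>
    have "ln (real k) powr a \<le> (real k powr (c / a) / (c / a)) powr a"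
      using k c a ln by (intro powr_mono2 ln_powr_bound) auto
    also have "\<dots> = (a / c) powr a * real k powr c"
      using c a k by (simp add: powr_mult powr_divide powr_powr)
    finally have lna: "ln (real k) powr a \<le> (a / c) powr a * real k powr c" .
    have "real k * (h powr a * exp (h * (\<delta> * real k)) * D) =
        (c / \<delta>) powr a * ln (real k) powr a * D * (real k powr (1 + c) * real k powr (- a))"
      unfolding hy using c \<delta> k ln
      by (simp add: h_def powr_mult powr_divide powr_add powr_minus field_simps)
    also have "\<dots> \<le> (c / \<delta>) powr a * ((a / c) powr a * real k powr c) * D * (real k powr (1 + c) * real k powr (- a))"
      using lna D by (intro mult_right_mono mult_left_mono) auto
    also have "\<dots> = B * (real k powr c * real k powr (1 + c) * real k powr (- a))"
      by (simp add: B_def)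
    also have "real k powr c * real k powr (1 + c) * real k powr (- a) = 1"
      using k by (simp add: powr_add[symmetric] c_def field_simps)
    finally have le: "real k * (h powr a * exp (h * (\<delta> * real k)) * D) \<le> B" by simp
    have eps: "h * \<epsilon> * real k / 2 = N * ln (real k)"
      using k c \<epsilon> N by (simp add: h_def \<delta>_def)
    have "prob {\<omega> \<in> space M. \<epsilon> * real k \<le> (\<Sum>i<k. V i \<omega>)} \<le>
        real k * prob {\<omega> \<in> space M. \<delta> * real k \<le> V 0 \<omega>} +
        exp (real k * (h powr a * exp (h * (\<delta> * real k)) * D) - h * \<epsilon> * real k / 2)"
      unfolding D_def
      by (rule chernoff_truncated) (use indep ident a moment mean h \<delta> in auto)
    also have "exp (real k * (h powr a * exp (h * (\<delta> * real k)) * D) - h * \<epsilon> * real k / 2) \<le>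
        exp (B - N * ln (real k))"
      using le by (simp add: eps)
    also have "\<dots> = exp B * real k powr (- N)"
      using k by (simp add: powr_def exp_diff exp_minus field_simps)
    finally show ?thesis by simp
  qed
  then show ?thesis
    using \<delta> by (intro that[of \<delta> "exp B"]) auto
qed

text \<open>The negative part of \<open>X 0\<close> is only integrable, so
  \<open>sum_large_deviation\<close> is applied to \<open>V i = max (X i) (- real j)\<close>. This
  dominates \<open>X i\<close>, and by dominated convergence its mean is below
  \<open>\<epsilon> / 2\<close> for a suitable \<open>j\<close>.\<close>

lemma centered_sum_large_deviation:
  fixes X :: "nat \<Rightarrow> 'a \<Rightarrow> real"
  assumes indep: "indep_vars (\<lambda>_. borel) X UNIV"
    and ident: "\<And>i. distr M borel (X i) = distr M borel (X 0)"
    and int: "integrable M (X 0)" and mean: "expectation (X 0) = 0"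
    and \<gamma>: "0 < \<gamma>"
    and moment: "integrable M (\<lambda>\<omega>. X 0 \<omega> powr (1 + \<gamma>) * indicator {\<omega>. X 0 \<omega> > 0} \<omega>)"
    and \<epsilon>: "0 < \<epsilon>" and N: "0 < N"
  obtains \<delta> C where "0 < \<delta>" "0 < C"
    "\<And>k. 0 < k \<Longrightarrow> prob {\<omega> \<in> space M. \<epsilon> * real k \<le> (\<Sum>i<k. X i \<omega>)} \<le>
      real k * prob {\<omega> \<in> space M. \<delta> * real k \<le> X 0 \<omega>} + C * real k powr (- N)"
proof -
  have X [measurable]: "X i \<in> borel_measurable M" for i
    using indep by (auto simp: indep_vars_def)
  have "(\<lambda>j. expectation (\<lambda>\<omega>. max (X 0 \<omega>) (- real j))) \<longlonglongrightarrow> expectation (X 0)"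
  proof (rule integral_dominated_convergence[where w = "\<lambda>\<omega>. \<bar>X 0 \<omega>\<bar>"])
    show "AE \<omega> in M. (\<lambda>j. max (X 0 \<omega>) (- real j)) \<longlonglongrightarrow> X 0 \<omega>"
    proof (rule AE_I2)
      fix \<omega>
      obtain n where n: "\<bar>X 0 \<omega>\<bar> \<le> real n" using real_arch_simple by blast
      show "(\<lambda>j. max (X 0 \<omega>) (- real j)) \<longlonglongrightarrow> X 0 \<omega>"
        by (rule tendsto_eventually) (use n in \<open>auto simp: eventually_sequentially intro!: exI[of _ n]\<close>)
    qed
  qed (use int in auto)
  then have "\<forall>\<^sub>F j in sequentially. expectation (\<lambda>\<omega>. max (X 0 \<omega>) (- real j)) < \<epsilon> / 2"
    using mean \<epsilon> by (intro order_tendstoD(2)) auto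
  then obtain j where j: "expectation (\<lambda>\<omega>. max (X 0 \<omega>) (- real j)) < \<epsilon> / 2"
    by (auto simp: eventually_sequentially)
  define V where "V i \<omega> = max (X i \<omega>) (- real j)" for i \<omega>
  have Vm [measurable]: "V i \<in> borel_measurable M" for i
    unfolding V_def by measurable
  define a where "a = min 2 (1 + \<gamma>)"
  have a: "1 < a" "a \<le> 2" "a \<le> 1 + \<gamma>" using \<gamma> by (auto simp: a_def)
  have V_moment: "integrable M (\<lambda>\<omega>. \<bar>V 0 \<omega>\<bar> powr a)"
  proof (rule Bochner_Integration.integrable_bound)
    show "integrable M (\<lambda>\<omega>. real j powr a + 1 + X 0 \<omega> powr (1 + \<gamma>) * indicator {\<omega>. X 0 \<omega> > 0} \<omega>)"
      by (intro Bochner_Integration.integrable_add moment) auto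
    have "\<bar>V 0 \<omega>\<bar> powr a \<le> real j powr a + 1 + X 0 \<omega> powr (1 + \<gamma>) * indicator {\<omega>. X 0 \<omega> > 0} \<omega>" for \<omega>
    proof -
      consider "X 0 \<omega> \<le> 0" | "0 < X 0 \<omega>" "X 0 \<omega> \<le> 1" | "1 < X 0 \<omega>" by linarith
      then show ?thesis
      proof cases
        case 1
        then have "\<bar>V 0 \<omega>\<bar> powr a \<le> real j powr a"
          using a by (intro powr_mono2) (auto simp: V_def)
        then show ?thesis by (simp add: add_increasing2)
      next
        case 2
        then have "\<bar>V 0 \<omega>\<bar> powr a \<le> 1"
          using a by (auto simp: V_def intro!: powr_le1)
        then show ?thesis by (intro add_increasing2 add_increasing) auto
      next
        case 3
        then have "\<bar>V 0 \<omega>\<bar> powr a \<le> X 0 \<omega> powr (1 + \<gamma>)"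
          using a by (auto simp: V_def intro!: powr_mono)
        then show ?thesis using 3 by (intro add_increasing) auto
      qed
    qed
    then show "AE \<omega> in M. norm (\<bar>V 0 \<omega>\<bar> powr a) \<le>
        norm (real j powr a + 1 + X 0 \<omega> powr (1 + \<gamma>) * indicator {\<omega>. X 0 \<omega> > 0} \<omega>)"
      by (intro AE_I2) (auto intro: order_trans)
  qed auto
  have V_indep: "indep_vars (\<lambda>_. borel) V UNIV"
    unfolding V_def
    by (rule indep_vars_compose2[where M' = "\<lambda>_. borel", OF indep]) auto
  have V_ident: "distr M borel (V i) = distr M borel (V 0)" for i
  proof -
    have "distr M borel (V l) = distr (distr M borel (X l)) borel (\<lambda>x. max x (- real j))" for l
      by (subst distr_distr) (auto simp: V_def[abs_def] comp_def)
    then show ?thesis using ident[of i] by simp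
  qed
  have V_mean: "expectation (V 0) \<le> \<epsilon> / 2"
    using j by (simp add: V_def[abs_def])
  obtain \<delta> C where \<delta>: "0 < \<delta>" "0 < C" and le:
    "\<And>k. 0 < k \<Longrightarrow> prob {\<omega> \<in> space M. \<epsilon> * real k \<le> (\<Sum>i<k. V i \<omega>)} \<le>
      real k * prob {\<omega> \<in> space M. \<delta> * real k \<le> V 0 \<omega>} + C * real k powr (- N)"
    using sum_large_deviation[OF V_indep V_ident a(1,2) V_moment V_mean \<epsilon> N] by blast
  have "prob {\<omega> \<in> space M. \<epsilon> * real k \<le> (\<Sum>i<k. X i \<omega>)} \<le>
      real k * prob {\<omega> \<in> space M. \<delta> * real k \<le> X 0 \<omega>} + C * real k powr (- N)"
    if k: "0 < k" for k
  proof -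
    have "(\<Sum>i<k. X i \<omega>) \<le> (\<Sum>i<k. V i \<omega>)" for \<omega>
      by (intro sum_mono) (auto simp: V_def)
    then have "prob {\<omega> \<in> space M. \<epsilon> * real k \<le> (\<Sum>i<k. X i \<omega>)} \<le>
        prob {\<omega> \<in> space M. \<epsilon> * real k \<le> (\<Sum>i<k. V i \<omega>)}"
      by (intro finite_measure_mono) (auto intro: order_trans)
    \<comment> \<open>Truncation from below does not affect the upper tail at positive
      levels.\<close>
    moreover have "{\<omega> \<in> space M. \<delta> * real k \<le> V 0 \<omega>} = {\<omega> \<in> space M. \<delta> * real k \<le> X 0 \<omega>}"
    proof -
      have "0 < \<delta> * real k" using k \<delta> by simp
      then show ?thesis by (auto simp: V_def le_max_iff_disj)
    qed
    ultimately show ?thesis using le[OF k] by simp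
  qed
  then show ?thesis using \<delta> that by blast
qed

text \<open>For \<open>b\<close> strictly between \<open>r\<close> and \<beta>, doubling a large
  argument shrinks the tail by at least \<open>2 powr (- b)\<close>. A dyadic decomposition then
  bounds the moment by a geometric series with ratio \<open>2 powr (r - b)\<close>.\<close>

lemma moment_of_regularly_varying_tail:
  fixes X :: "'a \<Rightarrow> real"
  assumes [measurable]: "X \<in> borel_measurable M"
    and L: "slowly_varying L"
    and tail: "(\<lambda>x. prob {\<omega> \<in> space M. X \<omega> \<ge> x}) \<sim>[at_top] (\<lambda>x. x powr (- \<beta>) * L x)"
    and r: "0 < r" "r < \<beta>"
  shows "integrable M (\<lambda>\<omega>. X \<omega> powr r * indicator {\<omega>. X \<omega> > 0} \<omega>)"
proof -
  define T where "T x = prob {\<omega> \<in> space M. X \<omega> \<ge> x}" for x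
  define g where "g x = x powr (- \<beta>) * L x" for x
  define b where "b = (r + \<beta>) / 2"
  have b: "r < b" "b < \<beta>" using r by (auto simp: b_def)
  have Lpos: "0 < L x" if "0 < x" for x
    using L that by (auto simp: slowly_varying_def)
  have g_pos: "0 < g x" if "0 < x" for x
    using Lpos that by (auto simp: g_def)
  have Tg: "((\<lambda>x. T x / g x) \<longlongrightarrow> 1) at_top"
  proof (rule asymp_equivD_strong)
    show "T \<sim>[at_top] g" using tail by (simp add: T_def[abs_def] g_def[abs_def])
    show "\<forall>\<^sub>F x in at_top. T x \<noteq> 0 \<or> g x \<noteq> 0"
      using eventually_gt_at_top[of 0] by eventually_elim (use g_pos in force)
  qed
  have two: "filterlim (\<lambda>x::real. 2 * x) at_top at_top"
    by (rule filterlim_tendsto_pos_mult_at_top[OF tendsto_const]) (auto simp: filterlim_ident)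
  \<comment> \<open>For large \<open>x\<close> this expression is \<open>T (2 * x) / T x\<close>,
    written through ratios with known limits; it tends to \<open>2 powr (- \<beta>)\<close>, which
    is below \<open>2 powr (- b)\<close>.\<close>
  have "((\<lambda>x. T (2 * x) / g (2 * x) * (2 powr (- \<beta>) * (L (2 * x) / L x)) / (T x / g x)) \<longlongrightarrow>
      1 * (2 powr (- \<beta>) * 1) / 1) at_top"
    using L by (intro tendsto_intros Tg filterlim_compose[OF Tg two]) (auto simp: slowly_varying_def)
  then have "\<forall>\<^sub>F x in at_top.
      T (2 * x) / g (2 * x) * (2 powr (- \<beta>) * (L (2 * x) / L x)) / (T x / g x) < 2 powr (- b)"
    using b by (intro order_tendstoD(2)) auto
  moreover have "\<forall>\<^sub>F x in at_top. 0 < T x / g x"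
    by (rule order_tendstoD(1)[OF Tg]) simp
  ultimately have "\<forall>\<^sub>F x in at_top. 0 < x \<and> T (2 * x) \<le> 2 powr (- b) * T x"
    using eventually_gt_at_top[of 0]
  proof eventually_elim
    case (elim x)
    have "g (2 * x) = 2 powr (- \<beta>) * (L (2 * x) / L x) * g x"
      using elim(3) Lpos[of x] by (simp add: g_def powr_mult)
    then have "T (2 * x) / g (2 * x) * (2 powr (- \<beta>) * (L (2 * x) / L x)) / (T x / g x) = T (2 * x) / T x"
      using elim(3) g_pos[of x] Lpos[of x] Lpos[of "2 * x"] by (simp add: field_simps)
    moreover have "0 < T x"
      using elim(2,3) g_pos[of x] by (simp add: zero_less_divide_iff)
    ultimately show ?case
      using elim by (auto simp: divide_less_eq)
  qed
  then obtain x0 where x0: "\<And>x. x0 \<le> x \<Longrightarrow> 0 < x \<and> T (2 * x) \<le> 2 powr (- b) * T x"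
    by (auto simp: eventually_at_top_linorder)
  have x0_pos: "0 < x0" using x0[of x0] by simp
  have T_le: "T (2 ^ j * x0) \<le> (2 powr (- b)) ^ j" for j
  proof (induction j)
    case 0
    then show ?case by (simp add: T_def)
  next
    case (Suc j)
    have "1 * x0 \<le> 2 ^ j * x0" using x0_pos by (intro mult_right_mono) auto
    then have "T (2 * (2 ^ j * x0)) \<le> 2 powr (- b) * T (2 ^ j * x0)"
      using x0 by simp
    also have "\<dots> \<le> 2 powr (- b) * (2 powr (- b)) ^ j"
      using Suc by (intro mult_left_mono) auto
    finally show ?case by (simp add: ac_simps)
  qed
  define w where "w j = (2 ^ Suc j * x0) powr r" for j :: nat
  \<comment> \<open>A value above \<open>x0\<close> lies between \<open>2 ^ j * x0\<close> and
    \<open>2 ^ Suc j * x0\<close> for some \<open>j\<close>, and \<open>w j\<close> is the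
    \<open>r\<close>-th power of the upper end.\<close>
  have cover: "ennreal (X \<omega> powr r * indicator {\<omega>. X \<omega> > 0} \<omega>) \<le>
      ennreal (x0 powr r) + (\<Sum>j. ennreal (w j) * indicator {\<omega> \<in> space M. X \<omega> \<ge> 2 ^ j * x0} \<omega>)"
    if \<omega>: "\<omega> \<in> space M" for \<omega>
  proof (cases "X \<omega> \<le> x0")
    case True
    then have "X \<omega> powr r * indicator {\<omega>. X \<omega> > 0} \<omega> \<le> x0 powr r"
      using r by (auto simp: indicator_def intro!: powr_mono2)
    then show ?thesis by (intro add_increasing2 ennreal_leI) auto
  next
    case False
    define j where "j = (LEAST j. X \<omega> \<le> 2 ^ Suc j * x0)"
    obtain n where n: "X \<omega> / x0 < 2 ^ n" using real_arch_pow[of 2] by auto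
    have "X \<omega> \<le> 2 ^ Suc n * x0" using n x0_pos False by (simp add: field_simps)
    then have upper: "X \<omega> \<le> 2 ^ Suc j * x0"
      unfolding j_def by (rule LeastI)
    have lower: "2 ^ j * x0 \<le> X \<omega>"
    proof (cases j)
      case 0
      then show ?thesis using False by simp
    next
      case (Suc i)
      then have "\<not> X \<omega> \<le> 2 ^ Suc i * x0"
        unfolding j_def by (intro not_less_Least) auto
      then show ?thesis using Suc by simp
    qed
    have "ennreal (X \<omega> powr r * indicator {\<omega>. X \<omega> > 0} \<omega>) \<le>
        ennreal (w j) * indicator {\<omega> \<in> space M. X \<omega> \<ge> 2 ^ j * x0} \<omega>"
      using upper lower False x0_pos r \<omega> by (auto simp: w_def indicator_def intro!: ennreal_leI powr_mono2)
    also have "\<dots> \<le> (\<Sum>j. ennreal (w j) * indicator {\<omega> \<in> space M. X \<omega> \<ge> 2 ^ j * x0} \<omega>)"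
      using sum_le_suminf[OF summableI, of "{j}" "\<lambda>j. ennreal (w j) * indicator {\<omega> \<in> space M. X \<omega> \<ge> 2 ^ j * x0} \<omega>"]
      by (simp del: sum_mult_indicator)
    finally show ?thesis by (intro add_increasing) auto
  qed
  define q where "q = 2 powr (r - b)"
  have q: "0 \<le> q" "q < 1"
    using b powr_less_mono[of "r - b" 0 2] by (auto simp: q_def)
  have wT: "w j * T (2 ^ j * x0) \<le> (2 * x0) powr r * q ^ j" for j
  proof -
    have "w j = (2 * x0) powr r * (2 powr r) ^ j"
      using x0_pos by (simp add: w_def powr_mult powr_realpow[symmetric] powr_powr mult.commute)
    then have "w j * T (2 ^ j * x0) \<le> (2 * x0) powr r * (2 powr r) ^ j * (2 powr (- b)) ^ j"
      using T_le by (auto intro!: mult_left_mono)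
    also have "\<dots> = (2 * x0) powr r * q ^ j"
      by (simp add: q_def power_mult_distrib[symmetric] powr_add[symmetric])
    finally show ?thesis .
  qed
  have "(\<integral>\<^sup>+\<omega>. ennreal (X \<omega> powr r * indicator {\<omega>. X \<omega> > 0} \<omega>) \<partial>M) \<le>
      (\<integral>\<^sup>+\<omega>. ennreal (x0 powr r) +
        (\<Sum>j. ennreal (w j) * indicator {\<omega> \<in> space M. X \<omega> \<ge> 2 ^ j * x0} \<omega>) \<partial>M)"
    by (intro nn_integral_mono cover)
  also have "\<dots> = ennreal (x0 powr r) + (\<Sum>j. ennreal (w j) * ennreal (T (2 ^ j * x0)))"
    by (subst nn_integral_add, simp, simp, subst nn_integral_suminf)
       (auto simp: nn_integral_cmult_indicator emeasure_eq_measure T_def prob_space)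
  also have "(\<Sum>j. ennreal (w j) * ennreal (T (2 ^ j * x0))) \<le> (\<Sum>j. ennreal ((2 * x0) powr r * q ^ j))"
  proof (intro suminf_le)
    fix j
    have "ennreal (w j) * ennreal (T (2 ^ j * x0)) = ennreal (w j * T (2 ^ j * x0))"
      by (simp add: ennreal_mult w_def T_def)
    then show "ennreal (w j) * ennreal (T (2 ^ j * x0)) \<le> ennreal ((2 * x0) powr r * q ^ j)"
      using wT[of j] by (simp add: ennreal_leI)
  qed auto
  also have "\<dots> = ennreal (\<Sum>j. (2 * x0) powr r * q ^ j)"
    using q by (intro suminf_ennreal2 summable_mult summable_geometric) auto
  finally have fin: "(\<integral>\<^sup>+\<omega>. ennreal (X \<omega> powr r * indicator {\<omega>. X \<omega> > 0} \<omega>) \<partial>M) < \<infinity>"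
    by (auto simp: top_unique less_top[symmetric])
  have [measurable]: "(\<lambda>\<omega>. X \<omega> powr r * indicator {\<omega>. X \<omega> > 0} \<omega>) \<in> borel_measurable M"
  proof -
    have "(\<lambda>\<omega>. X \<omega> powr r * indicator {\<omega>. X \<omega> > 0} \<omega>) = (\<lambda>\<omega>. X \<omega> powr r * indicator {0<..} (X \<omega>))"
      by (auto simp: indicator_def)
    then show ?thesis by simp
  qed
  show ?thesis
    using fin by (intro integrableI_bounded) (auto simp: indicator_def)
qed

end

section \<open>Summation over the population size\<close>

context supercritical
begin

text \<open>After exchanging sum and expectation, only the indices
  \<open>k \<le> X \<omega> / \<delta>\<close> contribute at \<omega>. Bounding the factor
  \<open>k\<close> by the largest such index and applying \<open>sum_scaled_limit_le\<close> leaves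
  a multiple of \<open>X \<omega> powr (1 + \<gamma>)\<close>.\<close>

lemma summable_scaled_limit_tail:
  fixes X :: "'b \<Rightarrow> real"
  assumes "prob_space M" and [measurable]: "X \<in> borel_measurable M"
    and moment: "integrable M (\<lambda>\<omega>. X \<omega> powr (1 + \<gamma>) * indicator {\<omega>. X \<omega> > 0} \<omega>)"
    and \<delta>: "0 < \<delta>"
  shows "summable (\<lambda>k. scaled_limit (Suc k) * (real (Suc k) *
    measure M {\<omega> \<in> space M. \<delta> * real (Suc k) \<le> X \<omega>}))"
proof -
  interpret prob_space M by fact
  obtain C where C: "0 < C" "\<And>K. 0 < K \<Longrightarrow> (\<Sum>k=1..K. scaled_limit k) \<le> C * real K powr \<gamma>"
    using sum_scaled_limit_le by blast
  define A where "A k = {\<omega> \<in> space M. \<delta> * real k \<le> X \<omega>}" for k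
  have [measurable]: "A k \<in> sets M" for k unfolding A_def by measurable
  define g where "g \<omega> = X \<omega> powr (1 + \<gamma>) * indicator {\<omega>. X \<omega> > 0} \<omega>" for \<omega>
  define D where "D = C * (1 / \<delta>) powr (1 + \<gamma>)"
  have D: "0 \<le> D" using C by (simp add: D_def)
  have pointwise: "(\<Sum>k=1..K. scaled_limit k * real k * indicator (A k) \<omega>) \<le> D * g \<omega>"
    if \<omega>: "\<omega> \<in> space M" for K \<omega>
  proof -
    \<comment> \<open>For negative \<open>X \<omega>\<close> the conversion \<open>nat\<close> gives
      0, in agreement with no positive \<open>k\<close> being counted.\<close>
    define n where "n = nat \<lfloor>X \<omega> / \<delta>\<rfloor>"
    have n: "\<omega> \<in> A k \<longleftrightarrow> k \<le> n" if "0 < k" for k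
    proof -
      have "\<omega> \<in> A k \<longleftrightarrow> real k \<le> X \<omega> / \<delta>"
        using \<delta> \<omega> by (simp add: A_def field_simps)
      also have "\<dots> \<longleftrightarrow> int k \<le> \<lfloor>X \<omega> / \<delta>\<rfloor>"
        by (simp add: le_floor_iff)
      also have "\<dots> \<longleftrightarrow> k \<le> n"
        using that unfolding n_def by linarith
      finally show ?thesis .
    qed
    show ?thesis
    proof (cases "n = 0")
      case True
      then have "(\<Sum>k=1..K. scaled_limit k * real k * indicator (A k) \<omega>) = 0"
        using n by (intro sum.neutral) auto
      also have "0 \<le> D * g \<omega>" using D by (simp add: g_def)
      finally show ?thesis .
    next
      case False
      then have "1 \<le> X \<omega> / \<delta>" "real n \<le> X \<omega> / \<delta>"
        unfolding n_def by linarith+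
      then have X: "0 < X \<omega>" "real n \<le> X \<omega> / \<delta>"
        using \<delta> by (auto simp: field_simps)
      have "(\<Sum>k=1..K. scaled_limit k * real k * indicator (A k) \<omega>) =
          (\<Sum>k\<in>{1..K} \<inter> {1..n}. scaled_limit k * real k)"
        using n by (intro sum.mono_neutral_cong_right)
          (auto simp: indicator_def simp del: Int_atLeastAtMost)
      also have "\<dots> \<le> (\<Sum>k=1..n. scaled_limit k * real k)"
        by (intro sum_mono2) (auto simp: scaled_limit_nonneg)
      also have "\<dots> \<le> (\<Sum>k=1..n. scaled_limit k * real n)"
        by (intro sum_mono mult_left_mono) (auto simp: scaled_limit_nonneg)
      also have "\<dots> = (\<Sum>k=1..n. scaled_limit k) * real n"
        by (simp add: sum_distrib_right)
      also have "\<dots> \<le> C * real n powr \<gamma> * real n"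
        using C False by (intro mult_right_mono) auto
      also have "\<dots> = C * real n powr (1 + \<gamma>)"
        using False by (simp add: powr_add)
      also have "\<dots> \<le> C * (X \<omega> / \<delta>) powr (1 + \<gamma>)"
        using C X \<gamma>_pos by (intro mult_left_mono powr_mono2) auto
      also have "\<dots> = D * g \<omega>"
        using X \<delta> by (simp add: D_def g_def powr_divide)
      finally show ?thesis .
    qed
  qed
  have "(\<Sum>i<K. scaled_limit (Suc i) * (real (Suc i) * prob (A (Suc i)))) \<le> D * expectation g" for K
  proof -
    have "(\<Sum>i<K. scaled_limit (Suc i) * (real (Suc i) * prob (A (Suc i)))) =
        (\<Sum>k=1..K. scaled_limit k * real k * prob (A k))"
      by (simp add: sum.atLeast1_atMost_eq ac_simps)
    also have "\<dots> = expectation (\<lambda>\<omega>. \<Sum>k=1..K. scaled_limit k * real k * indicator (A k) \<omega>)"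
      by (subst Bochner_Integration.integral_sum)
         (auto intro!: integrable_real_indicator simp: emeasure_eq_measure)
    also have "\<dots> \<le> expectation (\<lambda>\<omega>. D * g \<omega>)"
      using moment pointwise
      by (intro integral_mono Bochner_Integration.integrable_sum integrable_mult_right)
         (auto intro!: integrable_real_indicator simp: emeasure_eq_measure g_def[abs_def])
    finally show ?thesis by simp
  qed
  then show ?thesis
    unfolding A_def
    by (intro summableI_nonneg_bounded) (auto intro!: mult_nonneg_nonneg scaled_limit_nonneg)
qed

lemma summable_scaled_limit_powr:
  "summable (\<lambda>k. scaled_limit (Suc k) * real (Suc k) powr (- (\<gamma> + 2)))"
proof -
  obtain C where C: "0 < C" "\<And>K. 0 < K \<Longrightarrow> (\<Sum>k=1..K. scaled_limit k) \<le> C * real K powr \<gamma>"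
    using sum_scaled_limit_le by blast
  show ?thesis
  proof (rule summable_comparison_test')
    show "summable (\<lambda>k. C * real (Suc k) powr (- 2))"
      using summable_real_powr_iff[of "-2"] summable_Suc_iff[of "\<lambda>k. real k powr (- 2)"]
      by (intro summable_mult) simp
    fix k :: nat
    have "scaled_limit (Suc k) \<le> (\<Sum>i=1..Suc k. scaled_limit i)"
      by (intro member_le_sum) (auto simp: scaled_limit_nonneg)
    also have "\<dots> \<le> C * real (Suc k) powr \<gamma>" by (rule C) simp
    finally have "scaled_limit (Suc k) * real (Suc k) powr (- (\<gamma> + 2)) \<le>
        C * real (Suc k) powr \<gamma> * real (Suc k) powr (- (\<gamma> + 2))"
      by (intro mult_right_mono) auto
    also have "\<dots> = C * real (Suc k) powr (- 2)"
      by (simp add: powr_add[symmetric])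
    finally show "norm (scaled_limit (Suc k) * real (Suc k) powr (- (\<gamma> + 2))) \<le>
        C * real (Suc k) powr (- 2)"
      by (simp add: scaled_limit_nonneg)
  qed
qed

text \<open>Dominated convergence for series: the terms increase to their limits, so the limit
  series itself is the dominating one.\<close>

lemma scaled_law_suminf_limit:
  assumes a: "\<And>k. 0 \<le> a k" and summ: "summable (\<lambda>k. scaled_limit (Suc k) * a (Suc k))"
  shows "(\<lambda>n. \<Sum>k. scaled_law n (Suc k) * a (Suc k)) \<longlonglongrightarrow> (\<Sum>k. scaled_limit (Suc k) * a (Suc k))"
proof (rule tannerys_theorem[THEN conjunct2, THEN conjunct2, OF _ _ summ])
  show "(\<lambda>n. scaled_law n (Suc k) * a (Suc k)) \<longlonglongrightarrow> scaled_limit (Suc k) * a (Suc k)" for k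
    by (intro tendsto_mult_right scaled_law_tendsto) simp
  have "norm (scaled_law n (Suc k) * a (Suc k)) \<le> scaled_limit (Suc k) * a (Suc k)" for n k
    using scaled_law_le_limit[of "Suc k" n] a[of "Suc k"] scaled_law_nonneg[of n "Suc k"]
    by (simp add: abs_mult mult_right_mono)
  then show "\<forall>\<^sub>F (k, n) in at_top \<times>\<^sub>F sequentially.
      norm (scaled_law n (Suc k) * a (Suc k)) \<le> scaled_limit (Suc k) * a (Suc k)"
    by (intro always_eventually) auto
qed simp

end

lemma prob_random_sum:
  fixes Z :: "nat \<Rightarrow> 'a \<Rightarrow> nat" and X :: "nat \<Rightarrow> 'a \<Rightarrow> real"
  assumes "prob_space M" and indep: "indep_processes M Z X"
    and Zm: "\<And>n. Z n \<in> M \<rightarrow>\<^sub>M count_space UNIV" and Xm: "\<And>i. X i \<in> borel_measurable M"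
    and \<epsilon>: "0 < \<epsilon>"
  shows "(\<lambda>k. measure M {\<omega> \<in> space M. Z n \<omega> = Suc k} *
      measure M {\<omega> \<in> space M. partial_sum X (Suc k) \<omega> \<ge> \<epsilon> * real (Suc k)})
    sums measure M {\<omega> \<in> space M. partial_sum X (Z n \<omega>) \<omega> / real (Z n \<omega>) \<ge> \<epsilon>}"
proof -
  interpret prob_space M by fact
  note [measurable] = Zm Xm
  define A where "A k = {\<omega> \<in> space M. Z n \<omega> = k \<and> partial_sum X k \<omega> \<ge> \<epsilon> * real k}" for k
  have [measurable]: "A k \<in> sets M" for k
    unfolding A_def partial_sum_def by measurable
  have "(\<lambda>k. prob (A (Suc k))) sums prob (\<Union>k. A (Suc k))"
  proof (rule finite_measure_UNION)
    show "disjoint_family (\<lambda>k. A (Suc k))"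
      unfolding disjoint_family_on_def A_def by (simp add: set_eq_iff)
  qed auto
  moreover have "(\<Union>k. A (Suc k)) =
      {\<omega> \<in> space M. partial_sum X (Z n \<omega>) \<omega> / real (Z n \<omega>) \<ge> \<epsilon>}" (is "_ = ?B")
  proof (intro equalityI subsetI)
    fix \<omega> assume \<omega>: "\<omega> \<in> ?B"
    \<comment> \<open>For \<open>Z n \<omega> = 0\<close> the quotient is 0 by convention, hence
      below \<epsilon>; so the index 0 is absent from the series.\<close>
    then have "Z n \<omega> \<noteq> 0" using \<epsilon> by (intro notI) simp
    then have "\<omega> \<in> A (Suc (Z n \<omega> - 1))"
      using \<omega> by (simp add: A_def pos_le_divide_eq)
    then show "\<omega> \<in> (\<Union>k. A (Suc k))" by blast
  qed (auto simp: A_def pos_le_divide_eq simp del: of_nat_Suc)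
  moreover have "prob (A k) = prob {\<omega> \<in> space M. Z n \<omega> = k} *
      prob {\<omega> \<in> space M. partial_sum X k \<omega> \<ge> \<epsilon> * real k}" for k
  proof -
    \<comment> \<open>\<open>indep_var\<close> takes two variables of the same type, so \<open>indep_processes\<close> concerns the
      real-valued process \<open>real (Z n)\<close>.\<close>
    let ?S = "{z \<in> space (\<Pi>\<^sub>M n\<in>UNIV. count_space (UNIV :: real set)). z n = real k}"
    let ?T = "{x \<in> space (\<Pi>\<^sub>M i\<in>UNIV. borel). \<epsilon> * real k \<le> (\<Sum>i<k. x i)}"
    have 1: "?S \<in> sets (\<Pi>\<^sub>M n\<in>UNIV. count_space UNIV)" by measurable
    have 2: "?T \<in> sets (\<Pi>\<^sub>M i\<in>UNIV. (borel :: real measure))" by measurable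
    have "(\<lambda>\<omega>. (\<lambda>n. real (Z n \<omega>), \<lambda>i. X i \<omega>)) -` (?S \<times> ?T) \<inter> space M = A k"
      "(\<lambda>\<omega> n. real (Z n \<omega>)) -` ?S \<inter> space M = {\<omega> \<in> space M. Z n \<omega> = k}"
      "(\<lambda>\<omega> i. X i \<omega>) -` ?T \<inter> space M = {\<omega> \<in> space M. partial_sum X k \<omega> \<ge> \<epsilon> * real k}"
      by (auto simp: A_def partial_sum_def space_PiM)
    with indep_varD[OF indep[unfolded indep_processes_def] 1 2] show ?thesis by simp
  qed
  ultimately show ?thesis by simp
qed

theorem theorem1p13:
  fixes M :: "'a measure"
    and p :: "nat pmf" and Z :: "nat \<Rightarrow> 'a \<Rightarrow> nat" and m \<gamma> :: real
    and X :: "nat \<Rightarrow> 'a \<Rightarrow> real" and \<alpha> \<beta> :: real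
    and L b s :: "real \<Rightarrow> real" and \<mu> :: "real measure" and \<epsilon> :: real
  assumes "galton_watson M p Z"
    and "pmf p 0 = 0" and "0 < pmf p 1" and "pmf p 1 < 1"
    and "integrable (measure_pmf p) real"
    and "m = measure_pmf.expectation p real" and "m > 1"
    and "integrable M (\<lambda>\<omega>. real (Z 1 \<omega>) * ln (real (Z 1 \<omega>)))"
    and "\<gamma> > 0" and "pmf p 1 = m powr (- \<gamma>)"
    and "iid M X" and "indep_processes M Z X"
    and "assumption_A M X \<alpha> \<beta> L b s \<mu>"
    and "assumption_B M X \<alpha> \<beta> b s \<mu>"
    and "1 < \<alpha>" and "\<alpha> < 2"
    and "\<gamma> < \<beta> - 1 \<or>
         integrable M (\<lambda>\<omega>. X 0 \<omega> powr (1 + \<gamma>) * indicator {\<omega>. X 0 \<omega> > 0} \<omega>)"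
    and "\<epsilon> > 0"
  shows "(\<lambda>k. schroeder_q M Z m \<gamma> k *
            measure M {\<omega> \<in> space M. partial_sum X k \<omega> \<ge> \<epsilon> * real k}) summable_on {1..} \<and>
         (\<lambda>n. m powr (\<gamma> * real n) *
            measure M {\<omega> \<in> space M. partial_sum X (Z n \<omega>) \<omega> / real (Z n \<omega>) \<ge> \<epsilon>})
         \<longlonglongrightarrow> (\<Sum>\<^sub>\<infinity>k\<in>{1..}. schroeder_q M Z m \<gamma> k *
            measure M {\<omega> \<in> space M. partial_sum X k \<omega> \<ge> \<epsilon> * real k})"
proof -
  interpret prob_space M using assms(1) by (simp add: galton_watson_def)
  have Zm [measurable]: "Z n \<in> M \<rightarrow>\<^sub>M count_space UNIV" for n
    using assms(1) by (simp add: galton_watson_def)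
  have indep: "indep_vars (\<lambda>_. borel) X UNIV"
    and ident: "\<And>i. distr M borel (X i) = distr M borel (X 0)"
    using assms(11) by (auto simp: iid_def)
  have Xm [measurable]: "X i \<in> borel_measurable M" for i
    using indep by (auto simp: indep_vars_def)
  have law: "measure M {\<omega> \<in> space M. Z n \<omega> = k} = pmf (gw_law p n 1) k" for n k
    using assms(1) by (rule galton_watson_law)
  \<comment> \<open>This transfers the Z log Z condition from \<open>Z 1\<close> to the offspring
    law.\<close>
  have "distr M (count_space UNIV) (Z 1) = measure_pmf p"
  proof (rule measure_eqI_countable[where A = UNIV])
    fix k
    have "emeasure (distr M (count_space UNIV) (Z 1)) {k} = emeasure M {\<omega> \<in> space M. Z 1 \<omega> = k}"
      by (subst emeasure_distr) (auto intro!: arg_cong[where f = "emeasure M"])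
    then show "emeasure (distr M (count_space UNIV) (Z 1)) {k} = emeasure (measure_pmf p) {k}"
      using law[of 1 k] by (simp add: emeasure_eq_measure bind_return_pmf offspring_sum_1 emeasure_pmf_single)
  qed auto
  then have "integrable (measure_pmf p) (\<lambda>k. real k * ln (real k)) \<longleftrightarrow>
      integrable M (\<lambda>\<omega>. real (Z 1 \<omega>) * ln (real (Z 1 \<omega>)))"
    using integrable_distr_eq[OF Zm, of "\<lambda>k. real k * ln (real k)" 1] by simp
  with assms interpret supercritical p m \<gamma>
    by unfold_locales auto
  have moment: "integrable M (\<lambda>\<omega>. X 0 \<omega> powr (1 + \<gamma>) * indicator {\<omega>. X 0 \<omega> > 0} \<omega>)"
    using assms(17)
  proof
    assume "\<gamma> < \<beta> - 1"
    then show ?thesis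
      using assms(13) \<gamma>_pos
      by (intro moment_of_regularly_varying_tail[where L = L and \<beta> = \<beta>]) (auto simp: assumption_A_def)
  qed
  have int: "integrable M (X 0)" and mean: "expectation (X 0) = 0"
    using assms(13,15) by (auto simp: assumption_A_def)
  define a where "a k = prob {\<omega> \<in> space M. partial_sum X k \<omega> \<ge> \<epsilon> * real k}" for k
  \<comment> \<open>The decay exponent \<open>\<gamma> + 2\<close> makes the remainder summable
    against \<open>scaled_limit\<close>, which grows at most like
    \<open>k powr \<gamma>\<close>.\<close>
  obtain \<delta> C where \<delta>: "0 < \<delta>" "0 < C" and large_dev:
    "\<And>k. 0 < k \<Longrightarrow> prob {\<omega> \<in> space M. \<epsilon> * real k \<le> (\<Sum>i<k. X i \<omega>)} \<le>
      real k * prob {\<omega> \<in> space M. \<delta> * real k \<le> X 0 \<omega>} + C * real k powr (- (\<gamma> + 2))"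
    using centered_sum_large_deviation[OF indep ident int mean \<gamma>_pos moment \<open>\<epsilon> > 0\<close>, of "\<gamma> + 2"] \<gamma>_pos
    by auto
  have summ: "summable (\<lambda>k. scaled_limit (Suc k) * a (Suc k))"
  proof (rule summable_comparison_test')
    show "summable (\<lambda>k. scaled_limit (Suc k) * (real (Suc k) * prob {\<omega> \<in> space M. \<delta> * real (Suc k) \<le> X 0 \<omega>}) +
        C * (scaled_limit (Suc k) * real (Suc k) powr (- (\<gamma> + 2))))"
      by (intro summable_add summable_mult summable_scaled_limit_powr summable_scaled_limit_tail
          moment \<delta> prob_space_axioms Xm)
    fix k :: nat
    have "scaled_limit (Suc k) * a (Suc k) \<le> scaled_limit (Suc k) *
        (real (Suc k) * prob {\<omega> \<in> space M. \<delta> * real (Suc k) \<le> X 0 \<omega>} + C * real (Suc k) powr (- (\<gamma> + 2)))"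
      using large_dev[of "Suc k"] scaled_limit_nonneg[of "Suc k"]
      by (intro mult_left_mono) (auto simp: a_def partial_sum_def)
    then show "norm (scaled_limit (Suc k) * a (Suc k)) \<le>
        scaled_limit (Suc k) * (real (Suc k) * prob {\<omega> \<in> space M. \<delta> * real (Suc k) \<le> X 0 \<omega>}) +
        C * (scaled_limit (Suc k) * real (Suc k) powr (- (\<gamma> + 2)))"
      using scaled_limit_nonneg[of "Suc k"] by (simp add: a_def algebra_simps)
  qed
  have q: "schroeder_q M Z m \<gamma> = scaled_limit"
    by (simp add: fun_eq_iff schroeder_q_def scaled_limit_def scaled_law_def law)
  \<comment> \<open>The terms are nonnegative, so the ordered series is also an unordered sum, which
    is then reindexed along \<open>Suc\<close>.\<close>
  have "((\<lambda>k. scaled_limit (Suc k) * a (Suc k)) has_sum (\<Sum>k. scaled_limit (Suc k) * a (Suc k))) UNIV"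
    using summ scaled_limit_nonneg
    by (intro sums_nonneg_imp_has_sum summable_sums) (auto simp: a_def)
  moreover have "bij_betw Suc UNIV {1..}"
    by (rule bij_betwI[where g = "\<lambda>k. k - 1"]) auto
  ultimately have has_sum: "((\<lambda>k. scaled_limit k * a k) has_sum (\<Sum>k. scaled_limit (Suc k) * a (Suc k))) {1..}"
    using has_sum_reindex_bij_betw[of Suc UNIV "{1..}" "\<lambda>k. scaled_limit k * a k"] by simp
  have "m powr (\<gamma> * real n) *
      prob {\<omega> \<in> space M. partial_sum X (Z n \<omega>) \<omega> / real (Z n \<omega>) \<ge> \<epsilon>} =
      (\<Sum>k. scaled_law n (Suc k) * a (Suc k))" for n
    using sums_mult[OF prob_random_sum[OF prob_space_axioms \<open>indep_processes M Z X\<close> Zm Xm \<open>\<epsilon> > 0\<close>, of n],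
        of "m powr (\<gamma> * real n)"]
    by (simp add: sums_iff scaled_law_def law a_def ac_simps)
  then have "(\<lambda>n. m powr (\<gamma> * real n) *
      prob {\<omega> \<in> space M. partial_sum X (Z n \<omega>) \<omega> / real (Z n \<omega>) \<ge> \<epsilon>}) \<longlonglongrightarrow>
      (\<Sum>k. scaled_limit (Suc k) * a (Suc k))"
    using scaled_law_suminf_limit[of a, OF _ summ] by (simp add: a_def)
  with has_sum show ?thesis
    unfolding q a_def[symmetric] by (auto simp: summable_on_def dest: infsumI)
qed

end
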